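(* Let $p \geq 3$ be a prime, let $K=\mathbb{Q}_p(\zeta_p)$, where $\zeta_p$ is a primitive $p$-th root of unity, and let $\mathfrak{m}_K$ be the maximal ideal of the ring of integers of $K$. Then the image of the set $(1+\mathfrak{m}_K)\setminus(1+\mathfrak{m}_K^2)$ under the $p$-adic logarithm is exactly $\mathfrak{m}_K^2$, i.e. $$\log_p\left((1+\mathfrak{m}_K)\setminus(1+\mathfrak{m}_K^2)\right)=\mathfrak{m}_K^2.$$
   Context: $\mathcal{O}_K$ denotes the ring of integers of $K$ and $\mathfrak{m}_K$ its unique maximal ideal; $\mathfrak{m}_K^2$ is the square of this ideal. The $p$-adic logarithm on principal units $1+\mathfrak{m}_K$ is defined by the series $\log_p(1+x)=x-\frac{x^2}{2}+\frac{x^3}{3}-\cdots=\sum_{n\ge 1}(-1)^{n-1}\frac{x^n}{n}$, which converges in $K$ for all $x\in\mathfrak{m}_K$. *)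

theory Defs
  imports
    "HOL-Computational_Algebra.Computational_Algebra"
    "HOL-Algebra.QuotRing"
    "HOL-Algebra.Ideal_Product"
    "HOL-Algebra.Generated_Fields"
    "HOL-Algebra.Algebraic_Closure_Type"
begin

section \<open>The field of p-adic numbers\<close>

definition padic_val :: "nat \<Rightarrow> rat \<Rightarrow> int" where
  "padic_val p x =
     int (multiplicity (int p) (fst (quotient_of x))) - int (multiplicity (int p) (snd (quotient_of x)))"

definition padic_abs :: "nat \<Rightarrow> rat \<Rightarrow> real" where
  "padic_abs p x = (if x = 0 then 0 else real p powi (- padic_val p x))"

definition padic_Cauchy :: "nat \<Rightarrow> (nat \<Rightarrow> rat) \<Rightarrow> bool" where
  "padic_Cauchy p S \<longleftrightarrow> (\<forall>e>0. \<exists>N. \<forall>m\<ge>N. \<forall>n\<ge>N. padic_abs p (S m - S n) < e)"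

definition padic_null :: "nat \<Rightarrow> (nat \<Rightarrow> rat) \<Rightarrow> bool" where
  "padic_null p S \<longleftrightarrow> (\<forall>e>0. \<exists>N. \<forall>n\<ge>N. padic_abs p (S n) < e)"

definition padic_Cauchy_ring :: "nat \<Rightarrow> (nat \<Rightarrow> rat) ring" where
  "padic_Cauchy_ring p =
     \<lparr>carrier = {S. padic_Cauchy p S},
      monoid.mult = (\<lambda>S T n. S n * T n), one = (\<lambda>_. 1), zero = (\<lambda>_. 0), add = (\<lambda>S T n. S n + T n)\<rparr>"

text \<open>The completion of the rationals: Cauchy sequences modulo null sequences.
  That it is a field for prime \<open>p\<close> is proved in \<open>field_padic_field\<close> below.\<close>

definition padic_field :: "nat \<Rightarrow> (nat \<Rightarrow> rat) set ring" where
  "padic_field p = padic_Cauchy_ring p Quot {S. padic_null p S}"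

text \<open>The elements of absolute value at most one.\<close>

definition padic_integers :: "nat \<Rightarrow> (nat \<Rightarrow> rat) set set" where
  "padic_integers p = {C \<in> carrier (padic_field p). \<exists>S\<in>C. \<forall>n. padic_abs p (S n) \<le> 1}"

lemma padic_val_divide:
  assumes "Factorial_Ring.prime p" "a \<noteq> 0" "b \<noteq> 0"
  shows "padic_val p (of_int a / of_int b) = int (multiplicity (int p) a) - int (multiplicity (int p) b)"
proof -
  let ?x = "of_int a / of_int b :: rat"
  obtain c d where cd: "quotient_of ?x = (c, d)" by (cases "quotient_of ?x")
  have d: "d > 0" using quotient_of_denom_pos[OF cd] .
  have x: "?x = of_int c / of_int d" using quotient_of_div[OF cd] .
  have c: "c \<noteq> 0" using x assms d by auto
  have "of_int (a * d) = (of_int (c * b) :: rat)"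
    using x assms d by (simp add: field_simps)
  hence "a * d = c * b" by (simp only: of_int_eq_iff)
  moreover have "prime_elem (int p)" using assms(1) by simp
  ultimately have "multiplicity (int p) a + multiplicity (int p) d
      = multiplicity (int p) c + multiplicity (int p) b"
    using assms c d
    by (metis prime_elem_multiplicity_mult_distrib less_irrefl)
  thus ?thesis by (simp add: padic_val_def cd)
qed

lemma rat_common_denominator:
  fixes x y :: rat
  obtains a b c where "x = of_int a / of_int c" "y = of_int b / of_int c" "c \<noteq> 0"
proof -
  obtain a c where 1: "quotient_of x = (a, c)" by (cases "quotient_of x")
  obtain b d where 2: "quotient_of y = (b, d)" by (cases "quotient_of y")
  have cd: "c > 0" "d > 0" using quotient_of_denom_pos[OF 1] quotient_of_denom_pos[OF 2] .
  show ?thesis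
  proof (rule that)
    show "x = of_int (a * d) / of_int (c * d)" "y = of_int (b * c) / of_int (c * d)"
      using quotient_of_div[OF 1] quotient_of_div[OF 2] cd by (auto simp: field_simps)
    show "c * d \<noteq> 0" using cd by simp
  qed
qed

lemma padic_abs_nonneg: "padic_abs p x \<ge> 0"
  by (simp add: padic_abs_def)

lemma padic_abs_0 [simp]: "padic_abs p 0 = 0"
  by (simp add: padic_abs_def)

lemma padic_abs_1 [simp]: "padic_abs p 1 = 1"
  by (simp add: padic_abs_def padic_val_def rat_one_code)

lemma padic_abs_minus [simp]: "padic_abs p (- x) = padic_abs p x"
proof -
  have "quotient_of (- x) = (- fst (quotient_of x), snd (quotient_of x))"
    by (metis prod.collapse rat_uminus_code case_prod_conv)
  thus ?thesis by (simp add: padic_abs_def padic_val_def)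
qed

lemma padic_abs_minus_commute: "padic_abs p (x - y) = padic_abs p (y - x)"
  using padic_abs_minus[of p "x - y"] by simp

lemma padic_abs_pos: "Factorial_Ring.prime p \<Longrightarrow> x \<noteq> 0 \<Longrightarrow> padic_abs p x > 0"
  by (auto simp: padic_abs_def prime_gt_0_nat)

lemma padic_abs_mult:
  assumes "Factorial_Ring.prime p"
  shows "padic_abs p (x * y) = padic_abs p x * padic_abs p y"
proof (cases "x = 0 \<or> y = 0")
  case True thus ?thesis by auto
next
  case False
  obtain a b c where abc: "x = of_int a / of_int c" "y = of_int b / of_int c" "c \<noteq> 0"
    using rat_common_denominator .
  have nz: "a \<noteq> 0" "b \<noteq> 0" using False abc by auto
  have pe: "prime_elem (int p)" using assms by simp
  have xy: "x * y = of_int (a * b) / of_int (c * c)" using abc by simp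
  have "padic_val p (x * y) = padic_val p x + padic_val p y"
    unfolding xy using nz abc(3) padic_val_divide[OF assms]
    by (simp only: abc mult_eq_0_iff simp_thms padic_val_divide[OF assms]
        prime_elem_multiplicity_mult_distrib[OF pe] not_False_eq_True)
  moreover have "real p \<noteq> 0" using assms by auto
  ultimately show ?thesis using False
    by (simp add: padic_abs_def power_int_add[symmetric])
qed

lemma padic_abs_add:
  assumes "Factorial_Ring.prime p"
  shows "padic_abs p (x + y) \<le> max (padic_abs p x) (padic_abs p y)"
proof (cases "x = 0 \<or> y = 0 \<or> x + y = 0")
  case True thus ?thesis by (auto simp: padic_abs_nonneg le_max_iff_disj)
next
  case False
  obtain a b c where abc: "x = of_int a / of_int c" "y = of_int b / of_int c" "c \<noteq> 0"
    using rat_common_denominator .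
  have xy: "x + y = of_int (a + b) / of_int c" using abc by (simp add: add_divide_distrib)
  have nz: "a \<noteq> 0" "b \<noteq> 0" "a + b \<noteq> 0" using False abc xy by auto
  define k where "k = min (multiplicity (int p) a) (multiplicity (int p) b)"
  have "int p ^ k dvd a + b"
    by (intro dvd_add multiplicity_dvd') (auto simp: k_def)
  moreover have nu: "\<not> is_unit (int p)" using assms by auto
  ultimately have "k \<le> multiplicity (int p) (a + b)"
    using nz by (intro multiplicity_geI) auto
  hence "padic_val p (x + y) \<ge> min (padic_val p x) (padic_val p y)"
    using padic_val_divide[OF assms nz(1) abc(3)] padic_val_divide[OF assms nz(2) abc(3)]
      padic_val_divide[OF assms nz(3) abc(3)] unfolding xy[symmetric] abc(1,2)[symmetric] k_def
    by linarith
  hence "- padic_val p (x + y) \<le> - padic_val p x \<or> - padic_val p (x + y) \<le> - padic_val p y"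
    by linarith
  moreover have "real p \<ge> 1" using prime_ge_1_nat[OF assms] by simp
  ultimately show ?thesis using False
    by (auto simp: padic_abs_def le_max_iff_disj intro: power_int_increasing)
qed

lemma padic_abs_diff:
  assumes "Factorial_Ring.prime p"
  shows "padic_abs p (x - y) \<le> max (padic_abs p x) (padic_abs p y)"
  using padic_abs_add[OF assms, of x "- y"] by simp

lemma padic_null_imp_Cauchy:
  assumes "Factorial_Ring.prime p" "padic_null p S"
  shows "padic_Cauchy p S"
  unfolding padic_Cauchy_def
proof (intro allI impI)
  fix e :: real assume "e > 0"
  then obtain N where "\<forall>n\<ge>N. padic_abs p (S n) < e"
    using assms(2) unfolding padic_null_def by blast
  hence "\<forall>m\<ge>N. \<forall>n\<ge>N. padic_abs p (S m - S n) < e"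
    using padic_abs_diff[OF assms(1)] by (meson le_less_trans max_less_iff_conj)
  thus "\<exists>N. \<forall>m\<ge>N. \<forall>n\<ge>N. padic_abs p (S m - S n) < e" ..
qed

lemma padic_Cauchy_bounded:
  assumes "Factorial_Ring.prime p" "padic_Cauchy p S"
  obtains B where "B > 0" "\<And>n. padic_abs p (S n) \<le> B"
proof -
  obtain N where N: "\<forall>m\<ge>N. \<forall>n\<ge>N. padic_abs p (S m - S n) < 1"
    using assms(2) unfolding padic_Cauchy_def by (meson zero_less_one)
  define B where "B = Max (insert 1 ((\<lambda>n. padic_abs p (S n)) ` {..N}))"
  have B: "1 \<le> B" "\<And>n. n \<le> N \<Longrightarrow> padic_abs p (S n) \<le> B" unfolding B_def by (rule Max_ge; simp)+
  show ?thesis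
  proof (rule that[of B])
    show "B > 0" using B(1) by simp
    show "padic_abs p (S n) \<le> B" for n
    proof (cases "n \<le> N")
      case False
      have "padic_abs p (S n) \<le> max (padic_abs p (S n - S N)) (padic_abs p (S N))"
        using padic_abs_add[OF assms(1), of "S n - S N" "S N"] by simp
      also have "\<dots> \<le> B" using N False B(1) B(2)[of N]
        by (smt (verit) nle_le)
      finally show ?thesis .
    qed (use B in auto)
  qed
qed

lemma padic_Cauchy_add:
  assumes "Factorial_Ring.prime p" "padic_Cauchy p S" "padic_Cauchy p T"
  shows "padic_Cauchy p (\<lambda>n. S n + T n)"
  unfolding padic_Cauchy_def
proof (intro allI impI)
  fix e :: real assume "e > 0"
  then obtain M N where "\<forall>m\<ge>M. \<forall>n\<ge>M. padic_abs p (S m - S n) < e"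
      "\<forall>m\<ge>N. \<forall>n\<ge>N. padic_abs p (T m - T n) < e"
    using assms unfolding padic_Cauchy_def by meson
  hence MN: "padic_abs p ((S m - S n) + (T m - T n)) < e" if "m \<ge> max M N" "n \<ge> max M N" for m n
    using le_less_trans[OF padic_abs_add[OF assms(1)]] that by simp
  have "\<forall>m\<ge>max M N. \<forall>n\<ge>max M N. padic_abs p (S m + T m - (S n + T n)) < e"
    using MN by (simp add: algebra_simps)
  thus "\<exists>N. \<forall>m\<ge>N. \<forall>n\<ge>N. padic_abs p (S m + T m - (S n + T n)) < e" ..
qed

lemma padic_Cauchy_minus: "padic_Cauchy p S \<Longrightarrow> padic_Cauchy p (\<lambda>n. - S n)"
  unfolding padic_Cauchy_def by (simp add: padic_abs_minus_commute)

lemma padic_Cauchy_const: "padic_Cauchy p (\<lambda>_. c)"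
  unfolding padic_Cauchy_def by auto

lemma padic_Cauchy_mult:
  assumes "Factorial_Ring.prime p" "padic_Cauchy p S" "padic_Cauchy p T"
  shows "padic_Cauchy p (\<lambda>n. S n * T n)"
  unfolding padic_Cauchy_def
proof (intro allI impI)
  fix e :: real assume e: "e > 0"
  obtain B where B: "B > 0" "\<And>n. padic_abs p (S n) \<le> B"
    using padic_Cauchy_bounded[OF assms(1,2)] by blast
  obtain C where C: "C > 0" "\<And>n. padic_abs p (T n) \<le> C"
    using padic_Cauchy_bounded[OF assms(1,3)] by blast
  obtain M where M: "\<forall>m\<ge>M. \<forall>n\<ge>M. padic_abs p (S m - S n) < e / C"
    using assms(2) e C(1) unfolding padic_Cauchy_def by (meson divide_pos_pos)
  obtain N where N: "\<forall>m\<ge>N. \<forall>n\<ge>N. padic_abs p (T m - T n) < e / B"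
    using assms(3) e B(1) unfolding padic_Cauchy_def by (meson divide_pos_pos)
  have "padic_abs p (S m * T m - S n * T n) < e" if "m \<ge> max M N" "n \<ge> max M N" for m n
  proof -
    have "S m * T m - S n * T n = S m * (T m - T n) + (S m - S n) * T n"
      by (simp add: algebra_simps)
    hence "padic_abs p (S m * T m - S n * T n)
        \<le> max (padic_abs p (S m) * padic_abs p (T m - T n)) (padic_abs p (S m - S n) * padic_abs p (T n))"
      using padic_abs_add[OF assms(1)] by (simp add: padic_abs_mult[OF assms(1), symmetric])
    moreover have "padic_abs p (S m) * padic_abs p (T m - T n) < e"
    proof -
      have "padic_abs p (S m) * padic_abs p (T m - T n) \<le> B * padic_abs p (T m - T n)"
        by (intro mult_right_mono B padic_abs_nonneg)
      also have "\<dots> < B * (e / B)" using N that B(1) by (intro mult_strict_left_mono) auto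
      finally show ?thesis using B(1) by simp
    qed
    moreover have "padic_abs p (S m - S n) * padic_abs p (T n) < e"
    proof -
      have "padic_abs p (S m - S n) * padic_abs p (T n) \<le> padic_abs p (S m - S n) * C"
        by (intro mult_left_mono C padic_abs_nonneg)
      also have "\<dots> < (e / C) * C" using M that C(1) by (intro mult_strict_right_mono) auto
      finally show ?thesis using C(1) by simp
    qed
    ultimately show ?thesis by simp
  qed
  thus "\<exists>N. \<forall>m\<ge>N. \<forall>n\<ge>N. padic_abs p (S m * T m - S n * T n) < e" by blast
qed

lemma padic_null_mult:
  assumes "Factorial_Ring.prime p" "padic_Cauchy p S" "padic_null p T"
  shows "padic_null p (\<lambda>n. S n * T n)"
  unfolding padic_null_def
proof (intro allI impI)
  fix e :: real assume e: "e > 0"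
  obtain B where B: "B > 0" "\<And>n. padic_abs p (S n) \<le> B"
    using padic_Cauchy_bounded[OF assms(1,2)] by blast
  obtain N where N: "\<forall>n\<ge>N. padic_abs p (T n) < e / B"
    using assms(3) e B(1) unfolding padic_null_def by (meson divide_pos_pos)
  have "padic_abs p (S n * T n) < e" if "n \<ge> N" for n
  proof -
    have "padic_abs p (S n) * padic_abs p (T n) \<le> B * padic_abs p (T n)"
      by (intro mult_right_mono B padic_abs_nonneg)
    also have "\<dots> < B * (e / B)" using N that B(1) by (intro mult_strict_left_mono) auto
    finally show ?thesis using B(1) by (simp add: padic_abs_mult[OF assms(1)])
  qed
  thus "\<exists>N. \<forall>n\<ge>N. padic_abs p (S n * T n) < e" by blast
qed

lemma padic_null_add:
  assumes "Factorial_Ring.prime p" "padic_null p S" "padic_null p T"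
  shows "padic_null p (\<lambda>n. S n + T n)"
  unfolding padic_null_def
proof (intro allI impI)
  fix e :: real assume "e > 0"
  then obtain M N where "\<forall>n\<ge>M. padic_abs p (S n) < e" "\<forall>n\<ge>N. padic_abs p (T n) < e"
    using assms unfolding padic_null_def by meson
  hence "\<forall>n\<ge>max M N. padic_abs p (S n + T n) < e"
    using padic_abs_add[OF assms(1)] by (meson le_less_trans max.bounded_iff max_less_iff_conj)
  thus "\<exists>N. \<forall>n\<ge>N. padic_abs p (S n + T n) < e" ..
qed

lemma padic_null_minus: "padic_null p S \<Longrightarrow> padic_null p (\<lambda>n. - S n)"
  unfolding padic_null_def by simp

lemma padic_null_zero: "padic_null p (\<lambda>_. 0)"
  unfolding padic_null_def by auto

lemma padic_Cauchy_inverse: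
  assumes "Factorial_Ring.prime p" "padic_Cauchy p S" "\<not> padic_null p S"
  shows "padic_Cauchy p (\<lambda>n. inverse (S n))" "padic_null p (\<lambda>n. S n * inverse (S n) - 1)"
proof -
  obtain d where d: "d > 0" "\<And>N. \<exists>n\<ge>N. padic_abs p (S n) \<ge> d"
    using assms(3) unfolding padic_null_def by (meson not_less)
  obtain N where N: "\<forall>m\<ge>N. \<forall>n\<ge>N. padic_abs p (S m - S n) < d"
    using assms(2) d(1) unfolding padic_Cauchy_def by blast
  obtain m where m: "m \<ge> N" "padic_abs p (S m) \<ge> d" using d(2) by blast
  have low: "padic_abs p (S n) \<ge> d" if "n \<ge> N" for n
  proof (rule ccontr)
    assume "\<not> padic_abs p (S n) \<ge> d"
    moreover have "padic_abs p (S m) \<le> max (padic_abs p (S m - S n)) (padic_abs p (S n))"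
      using padic_abs_add[OF assms(1), of "S m - S n" "S n"] by simp
    moreover have "padic_abs p (S m - S n) < d" using N m that by blast
    ultimately show False using m by simp
  qed
  have nz: "S n \<noteq> 0" if "n \<ge> N" for n using low[OF that] d(1) by auto
  show "padic_null p (\<lambda>n. S n * inverse (S n) - 1)"
    unfolding padic_null_def using nz by (auto intro!: exI[of _ N])
  show "padic_Cauchy p (\<lambda>n. inverse (S n))"
    unfolding padic_Cauchy_def
  proof (intro allI impI)
    fix e :: real assume e: "e > 0"
    then obtain M where M: "\<forall>m\<ge>M. \<forall>n\<ge>M. padic_abs p (S m - S n) < e * (d * d)"
      using assms(2) d(1) unfolding padic_Cauchy_def by (meson mult_pos_pos)
    have "padic_abs p (inverse (S m) - inverse (S n)) < e" if mn: "m \<ge> max M N" "n \<ge> max M N" for m n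
    proof -
      have ge: "padic_abs p (S m) \<ge> d" "padic_abs p (S n) \<ge> d" using low mn by auto
      have "(inverse (S m) - inverse (S n)) * (S m * S n) = S n - S m"
        using nz mn by (simp add: field_simps)
      hence "padic_abs p (inverse (S m) - inverse (S n)) * (padic_abs p (S m) * padic_abs p (S n))
          = padic_abs p (S n - S m)"
        by (metis padic_abs_mult[OF assms(1)])
      also have "\<dots> < e * (d * d)" using M mn by auto
      also have "\<dots> \<le> e * (padic_abs p (S m) * padic_abs p (S n))"
        using e d(1) ge by (intro mult_left_mono mult_mono) auto
      finally show ?thesis using ge d(1) by (simp add: mult_less_cancel_right)
    qed
    thus "\<exists>N. \<forall>m\<ge>N. \<forall>n\<ge>N. padic_abs p (inverse (S m) - inverse (S n)) < e" by blast
  qed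
qed

lemma cring_padic_Cauchy_ring:
  assumes "Factorial_Ring.prime p"
  shows "cring (padic_Cauchy_ring p)"
proof (intro cringI abelian_groupI comm_monoidI)
  fix S assume "S \<in> carrier (padic_Cauchy_ring p)"
  thus "\<exists>T\<in>carrier (padic_Cauchy_ring p). T \<oplus>\<^bsub>padic_Cauchy_ring p\<^esub> S = \<zero>\<^bsub>padic_Cauchy_ring p\<^esub>"
    by (intro bexI[of _ "\<lambda>n. - S n"]) (auto simp: padic_Cauchy_ring_def intro: padic_Cauchy_minus)
qed (auto simp: padic_Cauchy_ring_def algebra_simps padic_Cauchy_const
      intro: padic_Cauchy_add padic_Cauchy_mult assms)

lemma maximalideal_padic_null:
  assumes p: "Factorial_Ring.prime p"
  shows "maximalideal {S. padic_null p S} (padic_Cauchy_ring p)"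
proof -
  let ?R = "padic_Cauchy_ring p" and ?I = "{S. padic_null p S}"
  interpret R: cring ?R using cring_padic_Cauchy_ring[OF p] .
  note simps = padic_Cauchy_ring_def
  have neg: "\<ominus>\<^bsub>?R\<^esub> S = (\<lambda>n. - S n)" if "padic_Cauchy p S" for S
    by (rule R.minus_equality) (use that in \<open>auto simp: simps intro: padic_Cauchy_minus\<close>)
  have I: "ideal ?I ?R"
  proof (rule idealI)
    show "ring ?R" by (rule R.ring_axioms)
    show "subgroup ?I (add_monoid ?R)"
    proof (rule R.add.subgroupI)
      show "?I \<subseteq> carrier ?R" using padic_null_imp_Cauchy[OF p] by (auto simp: simps)
      show "?I \<noteq> {}" using padic_null_zero by blast
    next
      fix S assume "S \<in> ?I"
      thus "\<ominus>\<^bsub>?R\<^esub> S \<in> ?I" using neg padic_null_imp_Cauchy[OF p] padic_null_minus by auto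
    next
      fix S T assume "S \<in> ?I" "T \<in> ?I"
      thus "S \<oplus>\<^bsub>?R\<^esub> T \<in> ?I" using padic_null_add[OF p] by (auto simp: simps)
    qed
    fix S T assume "S \<in> ?I" "T \<in> carrier ?R"
    thus "T \<otimes>\<^bsub>?R\<^esub> S \<in> ?I" "S \<otimes>\<^bsub>?R\<^esub> T \<in> ?I"
      using padic_null_mult[OF p, of T S] by (simp_all add: simps mult.commute)
  qed
  show ?thesis
  proof (rule maximalidealI[OF I])
    have "\<not> padic_null p (\<lambda>_. 1)" 
      unfolding padic_null_def by (metis less_irrefl order_refl padic_abs_1 zero_less_one)
    thus "carrier ?R \<noteq> ?I" using padic_Cauchy_const by (auto simp: simps)
  next
    fix J assume J: "ideal J ?R" "?I \<subseteq> J" "J \<subseteq> carrier ?R"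
    interpret J: ideal J ?R by (rule J(1))
    show "J = ?I \<or> J = carrier ?R"
    proof (rule disjCI)
      assume "J \<noteq> carrier ?R"
      have "padic_null p S" if S: "S \<in> J" for S
      proof (rule ccontr)
        assume nn: "\<not> padic_null p S"
        have SC: "padic_Cauchy p S" using S J(3) by (auto simp: simps)
        note inv = padic_Cauchy_inverse[OF p SC nn]
        have "(\<lambda>n. S n * inverse (S n)) \<in> J"
          using J.I_r_closed[OF S, of "\<lambda>n. inverse (S n)"] inv(1) by (simp add: simps)
        moreover have "(\<lambda>n. - (S n * inverse (S n) - 1)) \<in> J"
          using padic_null_minus[OF inv(2)] J(2) by blast
        ultimately have "(\<lambda>n. S n * inverse (S n) + - (S n * inverse (S n) - 1)) \<in> J"
          using J.a_closed by (fastforce simp: simps)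
        hence "\<one>\<^bsub>?R\<^esub> \<in> J" by (simp add: simps)
        thus False using J.one_imp_carrier \<open>J \<noteq> carrier ?R\<close> by blast
      qed
      thus "J = ?I" using J(2) by blast
    qed
  qed
qed

lemma field_padic_field:
  assumes "Factorial_Ring.prime p"
  shows "field (padic_field p)"
  unfolding padic_field_def
  by (intro maximalideal.quotient_is_field maximalideal_padic_null cring_padic_Cauchy_ring assms)

section \<open>Extensions of the p-adic numbers inside an ambient field\<close>

text \<open>
  The ambient field is a type \<open>'a\<close> of class \<open>field\<close>, an embedding \<open>emb\<close> of the p-adic numbers into it
  is given, and \<open>K\<close> is a subfield of \<open>'a\<close> that contains the image of \<open>emb\<close>.
\<close>

definition adjoin_root :: "nat \<Rightarrow> ((nat \<Rightarrow> rat) set \<Rightarrow> 'a::field) \<Rightarrow> 'a \<Rightarrow> 'a set" where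
  "adjoin_root p emb \<zeta> =
     generate_field ring_of_type_algebra (insert \<zeta> (emb ` carrier (padic_field p)))"

definition primitive_root_of_unity :: "nat \<Rightarrow> 'a::field \<Rightarrow> bool" where
  "primitive_root_of_unity n \<zeta> \<longleftrightarrow> n > 0 \<and> \<zeta> ^ n = 1 \<and> (\<forall>k. 0 < k \<and> k < n \<longrightarrow> \<zeta> ^ k \<noteq> 1)"

text \<open>The integral closure of the p-adic integers in \<open>K\<close>.\<close>

definition integers_of :: "nat \<Rightarrow> ((nat \<Rightarrow> rat) set \<Rightarrow> 'a::field) \<Rightarrow> 'a set \<Rightarrow> 'a ring" where
  "integers_of p emb K = ring_of_type_algebra
     \<lparr>carrier := {x \<in> K. \<exists>P :: 'a poly. Polynomial.lead_coeff P = 1 \<and>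
                    (\<forall>i. Polynomial.coeff P i \<in> emb ` padic_integers p) \<and> poly P x = 0}\<rparr>"

definition max_ideal_of :: "nat \<Rightarrow> ((nat \<Rightarrow> rat) set \<Rightarrow> 'a::field) \<Rightarrow> 'a set \<Rightarrow> 'a set" where
  "max_ideal_of p emb K = (THE M. maximalideal M (integers_of p emb K))"

text \<open>Convergence in the p-adic topology of \<open>K\<close>, in which the sets \<open>p\<^sup>k O\<^sub>K\<close>, with \<open>O\<^sub>K\<close> the
  ring of integers, form a basis of neighbourhoods of zero.\<close>

definition padic_tendsto ::
    "nat \<Rightarrow> ((nat \<Rightarrow> rat) set \<Rightarrow> 'a::field) \<Rightarrow> 'a set \<Rightarrow> (nat \<Rightarrow> 'a) \<Rightarrow> 'a \<Rightarrow> bool" where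
  "padic_tendsto p emb K f L \<longleftrightarrow>
     (\<forall>k. \<exists>N. \<forall>n\<ge>N. \<exists>y\<in>carrier (integers_of p emb K). f n - L = of_nat p ^ k * y)"

text \<open>The argument \<open>u\<close> is the principal unit \<open>1 + x\<close> itself; the value is the limit of the logarithm series
  in \<open>x = u - 1\<close>.\<close>

definition padic_log :: "nat \<Rightarrow> ((nat \<Rightarrow> rat) set \<Rightarrow> 'a::field) \<Rightarrow> 'a set \<Rightarrow> 'a \<Rightarrow> 'a" where
  "padic_log p emb K u =
     (THE L. L \<in> K \<and>
        padic_tendsto p emb K (\<lambda>N. \<Sum>n=1..N. (-1) ^ (n - 1) * (u - 1) ^ n / of_nat n) L)"

end

theory Submission
  imports "Jordan_Normal_Form.Char_Poly" "HOL-Number_Theory.Residues" Defs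
begin

text \<open>
  Put \<open>\<pi> = \<zeta> - 1\<close>. The equation \<open>(1 + \<pi>)\<^sup>p = 1\<close> is Eisenstein, so \<open>\<pi>\<^bsup>p-1\<^esup>\<close> is \<open>p\<close> times a unit, congruent to
  \<open>-p\<close> modulo \<open>p\<pi>\<close>; Nakayama's lemma and completeness make \<open>R = \<int>\<^sub>p[\<pi>]\<close> a discrete valuation ring with
  uniformizer \<open>\<pi>\<close> and residue field \<open>\<int>/p\<close>, which is therefore the ring of integers. On \<open>\<pi>R\<close> the terms of the
  logarithm series of index other than \<open>1\<close> and \<open>p\<close> lie in \<open>\<pi>\<^sup>2R\<close>, and \<open>x + x\<^sup>p / p\<close> lies there by Fermat's little
  theorem, which gives one inclusion. For the other, \<open>log (1 + x + h) \<equiv> log (1 + x) + h\<close> modulo \<open>\<pi>\<^bsup>k+1\<^esup>\<close>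
  whenever \<open>h\<close> is divisible by \<open>\<pi>\<^sup>k\<close> with \<open>k \<ge> 2\<close>, so every element of \<open>\<pi>\<^sup>2R\<close> is reached by successive
  approximation starting at \<open>x = \<pi>\<close>, without changing \<open>x\<close> modulo \<open>\<pi>\<^sup>2\<close>.
\<close>

section \<open>Integrality over a subring of a field\<close>

text \<open>The ambient field carries no valuation and no topology, so orders are expressed by the
  ideals \<open>E k\<close>, and it must be ruled out that \<open>p\<close> is invertible in
  \<open>R\<close>; Nakayama's lemma applied to the zero element does this. The obstacle on the side
  of the logarithm is ramification. As \<open>p\<close> has order \<open>p - 1\<close>, an increment
  \<open>h\<close> of order \<open>k\<close> makes \<open>h ^ p / p\<close> of order
  \<open>k * p - (p - 1)\<close>, which is \<open>k\<close> for \<open>k = 1\<close> and exceeds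
  \<open>k\<close> from \<open>k = 2\<close> on. This is the origin of the bound
  \<open>k \<ge> 2\<close>. On \<open>x = \<pi> * r\<close> the first order part of the logarithm is
  instead \<open>r - r ^ p\<close> in the residue field, which vanishes identically. Hence all of
  \<open>E 1\<close> drops into \<open>E 2\<close>, and the class of the starting point modulo
  \<open>E 2\<close> is free; \<open>\<pi>\<close> is the simplest choice outside
  \<open>E 2\<close>.\<close>

locale field_subring =
  fixes Z :: "'a::field set"
  assumes zero_mem [simp]: "0 \<in> Z"
    and one_mem [simp]: "1 \<in> Z"
    and add_mem: "x \<in> Z \<Longrightarrow> y \<in> Z \<Longrightarrow> x + y \<in> Z"
    and uminus_mem: "x \<in> Z \<Longrightarrow> - x \<in> Z"
    and mult_mem: "x \<in> Z \<Longrightarrow> y \<in> Z \<Longrightarrow> x * y \<in> Z"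
begin

lemma diff_mem: "x \<in> Z \<Longrightarrow> y \<in> Z \<Longrightarrow> x - y \<in> Z"
  using add_mem[of x "- y"] uminus_mem by simp

lemma sum_mem: "(\<And>i. i \<in> I \<Longrightarrow> f i \<in> Z) \<Longrightarrow> sum f I \<in> Z"
  by (induction I rule: infinite_finite_induct) (auto intro: add_mem)

lemma power_mem: "x \<in> Z \<Longrightarrow> x ^ n \<in> Z"
  by (induction n) (auto intro: mult_mem)

lemma of_nat_mem [simp]: "of_nat n \<in> Z"
  by (induction n) (auto intro: add_mem)

definition polys :: "'a poly set" where
  "polys = {P. \<forall>i. Polynomial.coeff P i \<in> Z}"

lemma coeff_mem: "P \<in> polys \<Longrightarrow> Polynomial.coeff P i \<in> Z"
  by (simp add: polys_def)

lemma polys_pConsD: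
  assumes "pCons c P \<in> polys"
  shows "c \<in> Z" "P \<in> polys"
proof -
  show "c \<in> Z" using coeff_mem[OF assms, of 0] by simp
  have "Polynomial.coeff P i \<in> Z" for i using coeff_mem[OF assms, of "Suc i"] by simp
  thus "P \<in> polys" by (simp add: polys_def)
qed

lemma polys_const: "c \<in> Z \<Longrightarrow> [:c:] \<in> polys"
  by (auto simp: polys_def Polynomial.coeff_pCons split: nat.splits)

lemma polys_X: "[:0, 1:] \<in> polys"
  by (auto simp: polys_def Polynomial.coeff_pCons split: nat.splits)

lemma polys_0: "0 \<in> polys" and polys_1: "1 \<in> polys"
  using polys_const[of 0] polys_const[of 1] by (simp_all add: one_pCons)

lemma polys_add: "P \<in> polys \<Longrightarrow> Q \<in> polys \<Longrightarrow> P + Q \<in> polys"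
  and polys_uminus: "P \<in> polys \<Longrightarrow> - P \<in> polys"
  and polys_mult: "P \<in> polys \<Longrightarrow> Q \<in> polys \<Longrightarrow> P * Q \<in> polys"
  by (auto simp: polys_def Polynomial.coeff_mult intro!: add_mem uminus_mem mult_mem sum_mem)

lemma polys_sum: "(\<And>i. i \<in> I \<Longrightarrow> f i \<in> polys) \<Longrightarrow> sum f I \<in> polys"
  by (induction I rule: infinite_finite_induct) (auto intro: polys_add polys_0)

lemma polys_prod: "(\<And>i. i \<in> I \<Longrightarrow> f i \<in> polys) \<Longrightarrow> prod f I \<in> polys"
  by (induction I rule: infinite_finite_induct) (auto intro: polys_mult polys_1)

lemma poly_mem: "P \<in> polys \<Longrightarrow> x \<in> Z \<Longrightarrow> poly P x \<in> Z"
  by (auto simp: poly_altdef intro!: sum_mem mult_mem power_mem coeff_mem)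

text \<open>The Leibniz formula builds the determinant from signs, products and sums, and
  \<open>polys\<close> is closed under these.\<close>

lemma char_poly_mem:
  assumes A: "A \<in> carrier_mat n n" and mem: "\<And>i j. i < n \<Longrightarrow> j < n \<Longrightarrow> A $$ (i, j) \<in> Z"
  shows "char_poly A \<in> polys"
proof -
  have dims: "dim_row (char_poly_matrix A) = n" "dim_col (char_poly_matrix A) = n"
    using A by (auto simp: char_poly_matrix_def)
  have entry: "char_poly_matrix A $$ (i, j) \<in> polys" if ij: "i < n" "j < n" for i j
  proof -
    have "char_poly_matrix A $$ (i, j) = (if i = j then [:0, 1:] else 0) + [:- (A $$ (i, j)):]"
      using ij A by (simp add: char_poly_matrix_def)
    thus ?thesis using mem[OF ij] polys_X polys_0
      by (simp only:) (intro polys_add polys_const uminus_mem, auto)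
  qed
  have sign: "(signof \<pi> :: 'a poly) \<in> polys" for \<pi> :: "nat \<Rightarrow> nat"
    using polys_1 polys_uminus[OF polys_1] by (auto simp: sign_def)
  show ?thesis
    unfolding char_poly_def Determinant.det_def dims
    by (auto intro!: polys_sum polys_mult polys_prod sign entry
        simp: permutes_in_image dest: permutes_in_image)
qed

text \<open>The determinant trick: an element that acts on a nonzero tuple through a matrix over \<open>Z\<close> is a
  root of the characteristic polynomial of the matrix.\<close>

lemma integral_of_matrix_action:
  fixes n :: nat
  assumes A: "\<And>i j. i < n \<Longrightarrow> j < n \<Longrightarrow> A i j \<in> Z"
    and act: "\<And>i. i < n \<Longrightarrow> x * v i = (\<Sum>j<n. A i j * v j)"
    and nz: "k < n" "v k \<noteq> 0"
  obtains P where "Polynomial.lead_coeff P = 1" "P \<in> polys" "poly P x = 0"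
proof -
  define M where "M = mat n n (\<lambda>(i, j). A i j)"
  have M: "M \<in> carrier_mat n n" by (simp add: M_def)
  have "eigenvector M (vec n v) x"
    unfolding eigenvector_def
  proof (intro conjI)
    show "vec n v \<in> carrier_vec (dim_row M)" using M by simp
    show "vec n v \<noteq> 0\<^sub>v (dim_row M)" using nz M by (metis carrier_matD(1) index_vec index_zero_vec(1))
    show "M *\<^sub>v vec n v = x \<cdot>\<^sub>v vec n v"
      using act by (intro eq_vecI) (auto simp: M_def scalar_prod_def atLeast0LessThan)
  qed
  hence "poly (char_poly M) x = 0"
    using eigenvalue_root_char_poly[OF M, of x] by (auto simp: eigenvalue_def)
  moreover have "Polynomial.lead_coeff (char_poly M) = 1"
    using degree_monic_char_poly[OF M] by simp
  moreover have "char_poly M \<in> polys"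
    by (rule char_poly_mem[OF M]) (auto simp: M_def A)
  ultimately show ?thesis using that by blast
qed

end

section \<open>The p-adic numbers inside the ambient field\<close>

lemma padic_abs_prime_power:
  assumes "Factorial_Ring.prime p"
  shows "padic_abs p (of_nat p ^ k) = 1 / real p ^ k"
proof -
  have "padic_abs p (of_nat p) = 1 / real p"
  proof -
    have "padic_val p (of_int (int p) / of_int 1) = 1"
      using assms by (subst padic_val_divide) (auto simp: prime_gt_0_nat)
    thus ?thesis using assms by (auto simp: padic_abs_def power_int_minus divide_inverse)
  qed
  thus ?thesis
    by (induction k) (auto simp: padic_abs_mult[OF assms])
qed

lemma padic_abs_cases:
  assumes "Factorial_Ring.prime p" "x \<noteq> 0"
  obtains k :: nat where "padic_abs p x = 1 / real p ^ k" | k :: nat where "k > 0" "padic_abs p x = real p ^ k"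
proof (cases "padic_val p x \<ge> 0")
  case True
  hence "padic_abs p x = 1 / real p ^ nat (padic_val p x)"
    using assms by (auto simp: padic_abs_def divide_inverse power_int_def power_inverse)
  thus ?thesis using that by blast
next
  case False
  hence "padic_abs p x = real p ^ nat (- padic_val p x)" "nat (- padic_val p x) > 0"
    using assms by (auto simp: padic_abs_def power_int_def)
  thus ?thesis using that by blast
qed

text \<open>Nonzero values are integral powers of \<open>p\<close>, so none lies strictly between
  \<open>1 / p\<close> and 1. This turns a strict Cauchy estimate into a congruence modulo
  \<open>p\<close>.\<close>

lemma padic_abs_lt_1:
  assumes "Factorial_Ring.prime p" "padic_abs p x < 1"
  shows "padic_abs p x \<le> 1 / real p"
proof (cases "x = 0")
  case False
  have p: "real p > 1" using assms by (simp add: prime_gt_Suc_0_nat)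
  show ?thesis using assms(1) False
  proof (cases rule: padic_abs_cases)
    case (1 k)
    hence "k \<noteq> 0" using assms(2) by (intro notI) auto
    hence "real p ^ 1 \<le> real p ^ k" using p by (intro power_increasing) auto
    hence "1 / real p ^ k \<le> 1 / real p ^ 1" using p by (intro divide_left_mono) auto
    thus ?thesis using 1 by simp
  next
    case (2 k)
    moreover have "1 \<le> real p ^ k" using p by (intro one_le_power) simp
    ultimately show ?thesis using assms(2) by linarith
  qed
qed simp

lemma padic_abs_of_int_le_1:
  assumes "Factorial_Ring.prime p"
  shows "padic_abs p (of_int a) \<le> 1"
proof (cases "a = 0")
  case False
  have "padic_val p (of_int a / of_int 1) = int (multiplicity (int p) a)"
    using assms False by (subst padic_val_divide) auto
  thus ?thesis using assms False prime_ge_1_nat[OF assms]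
    by (auto simp: padic_abs_def power_int_def power_inverse inverse_le_1_iff)
qed simp

lemma padic_abs_of_int_dvd:
  assumes "Factorial_Ring.prime p" "int p dvd a"
  shows "padic_abs p (of_int a) \<le> 1 / real p"
proof -
  obtain b where "a = int p * b" using assms(2) by auto
  hence "padic_abs p (of_int a) = padic_abs p (of_nat p ^ 1) * padic_abs p (of_int b)"
    using padic_abs_mult[OF assms(1)] by simp
  also have "\<dots> \<le> padic_abs p (of_nat p ^ 1) * 1"
    by (intro mult_left_mono padic_abs_of_int_le_1 assms padic_abs_nonneg)
  finally show ?thesis using padic_abs_prime_power[OF assms(1), of 1] by simp
qed

text \<open>In lowest terms the denominator is prime to \<open>p\<close>, since otherwise the
  absolute value would exceed 1; the residue is the numerator times the inverse of the denominator
  modulo \<open>p\<close>.\<close>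

lemma padic_residue:
  assumes p: "Factorial_Ring.prime p" and x: "padic_abs p x \<le> 1"
  obtains a :: nat where "padic_abs p (x - of_nat a) \<le> 1 / real p"
proof -
  obtain u v where q: "quotient_of x = (u, v)" by (cases "quotient_of x")
  have v: "v > 0" "coprime u v" using quotient_of_denom_pos[OF q] quotient_of_coprime[OF q] .
  have xuv: "x = of_int u / of_int v" using quotient_of_div[OF q] .
  have pv: "\<not> int p dvd v"
  proof
    assume dvd: "int p dvd v"
    hence "\<not> int p dvd u" using v p by (metis coprime_common_divisor not_prime_unit prime_nat_int_transfer)
    hence "u \<noteq> 0" by auto
    have "padic_val p x = - int (multiplicity (int p) v)"
      using \<open>\<not> int p dvd u\<close> q by (simp add: padic_val_def not_dvd_imp_multiplicity_0)
    moreover have "multiplicity (int p) v > 0"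
      using dvd v p by (subst prime_multiplicity_gt_zero_iff) auto
    ultimately have "padic_abs p x = real p ^ multiplicity (int p) v"
      using \<open>u \<noteq> 0\<close> xuv v by (auto simp: padic_abs_def power_int_def)
    moreover have "1 < real p ^ multiplicity (int p) v"
      using \<open>multiplicity (int p) v > 0\<close> p by (intro one_less_power) (auto simp: prime_gt_Suc_0_nat)
    ultimately show False using x by simp
  qed
  hence "coprime v (int p)" using p by (metis coprime_commute prime_imp_coprime prime_nat_int_transfer)
  then obtain w where w: "[v * w = 1] (mod int p)" using cong_solve_coprime_int by blast
  define a where "a = nat ((u * w) mod int p)"
  have ia: "int a = (u * w) mod int p" using p by (simp add: a_def prime_gt_0_nat)
  have "[v * int a = u] (mod int p)"
  proof -
    have "[v * int a = v * (u * w)] (mod int p)" unfolding ia by (intro cong_scalar_left) simp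
    also have "v * (u * w) = u * (v * w)" by (simp add: ac_simps)
    also have "[u * (v * w) = u * 1] (mod int p)" by (intro cong_scalar_left w)
    finally show ?thesis by simp
  qed
  hence "int p dvd u - v * int a" by (metis cong_iff_dvd_diff cong_sym)
  hence "padic_abs p (of_int (u - v * int a)) \<le> 1 / real p" by (rule padic_abs_of_int_dvd[OF p])
  moreover have "of_int (u - v * int a) = (x - of_nat a) * of_int v"
    using v by (simp add: xuv field_simps)
  moreover have "padic_abs p (of_int v) = 1"
  proof -
    have "padic_val p (of_int v / of_int 1) = 0"
      using p v pv by (subst padic_val_divide) (auto simp: not_dvd_imp_multiplicity_0)
    thus ?thesis using v by (simp add: padic_abs_def)
  qed
  ultimately have "padic_abs p (x - of_nat a) \<le> 1 / real p" by (simp add: padic_abs_mult[OF p])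
  thus ?thesis by (rule that)
qed

text \<open>By the ultrametric inequality a chain of steps is no larger than its largest step, which
  is the first one in the bound.\<close>

lemma padic_CauchyI_steps:
  assumes p: "Factorial_Ring.prime p"
    and step: "\<And>n. padic_abs p (q (Suc n) - q n) \<le> 1 / real p ^ n"
  shows "padic_Cauchy p q" "n \<le> m \<Longrightarrow> padic_abs p (q m - q n) \<le> 1 / real p ^ n"
proof -
  have p1: "real p > 1" using p by (simp add: prime_gt_Suc_0_nat)
  have diff: "padic_abs p (q m - q n) \<le> 1 / real p ^ n" if "n \<le> m" for m n
    using that
  proof (induction m rule: dec_induct)
    case (step m)
    have "padic_abs p (q (Suc m) - q n) \<le> max (padic_abs p (q (Suc m) - q m)) (padic_abs p (q m - q n))"
      using padic_abs_add[OF p, of "q (Suc m) - q m" "q m - q n"] by simp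
    moreover have "1 / real p ^ m \<le> 1 / real p ^ n"
      using p1 step.hyps by (intro divide_left_mono power_increasing) auto
    ultimately show ?case using step.IH assms(2)[of m] by linarith
  qed (use p1 in simp)
  thus "n \<le> m \<Longrightarrow> padic_abs p (q m - q n) \<le> 1 / real p ^ n" .
  show "padic_Cauchy p q"
    unfolding padic_Cauchy_def
  proof (intro allI impI)
    fix e :: real assume "e > 0"
    then obtain N where "(1 / real p) ^ N < e"
      using p1 real_arch_pow_inv[of e "1 / real p"] by auto
    hence N: "1 / real p ^ N < e" by (simp add: power_divide)
    have "padic_abs p (q m - q n) < e" if "m \<ge> N" "n \<ge> N" for m n
      using padic_abs_diff[OF p, of "q m - q N" "q n - q N"] diff[OF that(1)] diff[OF that(2)] N by simp
    thus "\<exists>N. \<forall>m\<ge>N. \<forall>n\<ge>N. padic_abs p (q m - q n) < e" by blast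
  qed
qed

section \<open>Rational Cauchy sequences as names for elements of the ambient field\<close>

locale padic_embedding =
  fixes p :: nat and emb :: "(nat \<Rightarrow> rat) set \<Rightarrow> 'a::field"
  assumes prime_p: "Factorial_Ring.prime p"
    and emb_hom: "emb \<in> ring_hom (padic_field p) ring_of_type_algebra"
begin

lemma p_gt_1: "real p > 1"
  using prime_p by (simp add: prime_gt_Suc_0_nat)

definition seq_class :: "(nat \<Rightarrow> rat) \<Rightarrow> (nat \<Rightarrow> rat) set" where
  "seq_class S = {T. padic_null p T} +>\<^bsub>padic_Cauchy_ring p\<^esub> S"

text \<open>The p-adic limit of a rational Cauchy sequence, seen in the ambient field. Statements
  about the embedded p-adic numbers are reduced through it to absolute values of rationals.\<close>

definition lim_emb :: "(nat \<Rightarrow> rat) \<Rightarrow> 'a" where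
  "lim_emb S = emb (seq_class S)"

lemma null_ideal: "ideal {T. padic_null p T} (padic_Cauchy_ring p)"
  using maximalideal_padic_null[OF prime_p] by (rule maximalideal.axioms)

lemma lim_emb_hom: "lim_emb \<in> ring_hom (padic_Cauchy_ring p) ring_of_type_algebra"
proof -
  have "seq_class \<in> ring_hom (padic_Cauchy_ring p) (padic_field p)"
    unfolding seq_class_def[abs_def] padic_field_def by (rule ideal.rcos_ring_hom[OF null_ideal])
  from ring_hom_trans[OF this emb_hom] show ?thesis by (simp add: lim_emb_def[abs_def] o_def)
qed

lemma lim_emb_add:
  "padic_Cauchy p S \<Longrightarrow> padic_Cauchy p T \<Longrightarrow> lim_emb (\<lambda>n. S n + T n) = lim_emb S + lim_emb T"
  using ring_hom_add[OF lim_emb_hom, of S T]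
  by (simp add: padic_Cauchy_ring_def ring_of_type_algebra_def)

lemma lim_emb_mult:
  "padic_Cauchy p S \<Longrightarrow> padic_Cauchy p T \<Longrightarrow> lim_emb (\<lambda>n. S n * T n) = lim_emb S * lim_emb T"
  using ring_hom_mult[OF lim_emb_hom, of S T]
  by (simp add: padic_Cauchy_ring_def ring_of_type_algebra_def)

lemma lim_emb_1: "lim_emb (\<lambda>_. 1) = 1"
  using ring_hom_one[OF lim_emb_hom] by (simp add: padic_Cauchy_ring_def ring_of_type_algebra_def)

lemma lim_emb_0: "lim_emb (\<lambda>_. 0) = 0"
  using lim_emb_add[OF padic_Cauchy_const padic_Cauchy_const, of 0 0] by (metis add.right_neutral add_left_cancel)

lemma lim_emb_uminus: "padic_Cauchy p S \<Longrightarrow> lim_emb (\<lambda>n. - S n) = - lim_emb S"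
  using lim_emb_add[of S "\<lambda>n. - S n"] by (simp add: padic_Cauchy_minus lim_emb_0 eq_neg_iff_add_eq_0 add.commute)

lemma padic_Cauchy_diff: "padic_Cauchy p S \<Longrightarrow> padic_Cauchy p T \<Longrightarrow> padic_Cauchy p (\<lambda>n. S n - T n)"
  using padic_Cauchy_add[OF prime_p _ padic_Cauchy_minus, of S T] by simp

lemma lim_emb_diff:
  "padic_Cauchy p S \<Longrightarrow> padic_Cauchy p T \<Longrightarrow> lim_emb (\<lambda>n. S n - T n) = lim_emb S - lim_emb T"
  using lim_emb_add[of S "\<lambda>n. - T n"] by (simp add: padic_Cauchy_minus lim_emb_uminus)

lemma lim_emb_of_nat: "lim_emb (\<lambda>_. of_nat n) = of_nat n"
  by (induction n) (simp_all add: lim_emb_0 lim_emb_1 lim_emb_add padic_Cauchy_const)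

lemma lim_emb_power_p: "lim_emb (\<lambda>_. of_nat p ^ k) = of_nat p ^ k"
  using lim_emb_of_nat[of "p ^ k"] by simp

lemma lim_emb_null: "padic_null p S \<Longrightarrow> lim_emb S = 0"
proof -
  assume S: "padic_null p S"
  interpret ideal "{T. padic_null p T}" "padic_Cauchy_ring p" by (rule null_ideal)
  have "seq_class S = {T. padic_null p T}"
    unfolding seq_class_def using S by (intro a_coset_join2 a_subgroup) (auto simp: Icarr)
  moreover have "seq_class (\<lambda>_. 0) = {T. padic_null p T}"
    unfolding seq_class_def using padic_null_zero by (intro a_coset_join2 a_subgroup) (auto simp: Icarr)
  ultimately show ?thesis using lim_emb_0 by (simp add: lim_emb_def)
qed

text \<open>A sequence that is not null has a termwise inverse up to a null sequence, so its image
  has an inverse too; injectivity of the embedding follows.\<close>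

lemma lim_emb_inverse:
  assumes "padic_Cauchy p S" "\<not> padic_null p S"
  shows "lim_emb (\<lambda>n. inverse (S n)) = inverse (lim_emb S)" "lim_emb S \<noteq> 0"
proof -
  note inv = padic_Cauchy_inverse[OF prime_p assms]
  have "lim_emb (\<lambda>n. S n * inverse (S n) - 1) = lim_emb S * lim_emb (\<lambda>n. inverse (S n)) - 1"
    using assms(1) inv(1)
    by (simp add: lim_emb_diff lim_emb_mult lim_emb_1 padic_Cauchy_const padic_Cauchy_mult[OF prime_p])
  hence *: "lim_emb S * lim_emb (\<lambda>n. inverse (S n)) = 1" using lim_emb_null[OF inv(2)] by simp
  thus "lim_emb (\<lambda>n. inverse (S n)) = inverse (lim_emb S)" by (metis inverse_unique)
  show "lim_emb S \<noteq> 0" using * by auto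
qed

lemma lim_emb_eq_0_iff: "padic_Cauchy p S \<Longrightarrow> lim_emb S = 0 \<longleftrightarrow> padic_null p S"
  using lim_emb_null lim_emb_inverse(2) by blast

section \<open>Embedded p-adic numbers and integers: divisibility, residues, units,
  completeness\<close>

definition Qp :: "'a set" where "Qp = emb ` carrier (padic_field p)"

definition Zp :: "'a set" where "Zp = emb ` padic_integers p"

lemma carrier_padic_field: "carrier (padic_field p) = seq_class ` {S. padic_Cauchy p S}"
  unfolding padic_field_def FactRing_def A_RCOSETS_def' seq_class_def
  by (simp add: padic_Cauchy_ring_def UNION_singleton_eq_range)

lemma Qp_eq: "Qp = lim_emb ` {S. padic_Cauchy p S}"
  by (auto simp: Qp_def carrier_padic_field lim_emb_def)

lemma seq_class_mem:
  assumes "padic_Cauchy p T" "S \<in> seq_class T"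
  shows "padic_Cauchy p S" "seq_class S = seq_class T"
proof -
  interpret ideal "{T. padic_null p T}" "padic_Cauchy_ring p" by (rule null_ideal)
  have T: "T \<in> carrier (padic_Cauchy_ring p)" using assms(1) by (simp add: padic_Cauchy_ring_def)
  show "seq_class S = seq_class T"
    using a_repr_independence[OF assms(2)[unfolded seq_class_def] T a_subgroup] by (simp add: seq_class_def)
  have "S \<in> carrier (padic_Cauchy_ring p)"
    using a_elemrcos_carrier[OF T assms(2)[unfolded seq_class_def]] .
  thus "padic_Cauchy p S" by (simp add: padic_Cauchy_ring_def)
qed

lemma seq_class_self: "padic_Cauchy p S \<Longrightarrow> S \<in> seq_class S"
proof -
  assume "padic_Cauchy p S"
  interpret ideal "{T. padic_null p T}" "padic_Cauchy_ring p" by (rule null_ideal)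
  show ?thesis unfolding seq_class_def
    using \<open>padic_Cauchy p S\<close> by (intro a_rcos_self) (simp add: padic_Cauchy_ring_def)
qed

lemma Zp_eq: "Zp = lim_emb ` {S. padic_Cauchy p S \<and> (\<forall>n. padic_abs p (S n) \<le> 1)}"
proof -
  have "padic_integers p = seq_class ` {S. padic_Cauchy p S \<and> (\<forall>n. padic_abs p (S n) \<le> 1)}"
    (is "_ = ?B")
  proof (intro equalityI subsetI)
    fix C assume "C \<in> padic_integers p"
    then obtain T S where T: "padic_Cauchy p T" "C = seq_class T" and S: "S \<in> C" "\<forall>n. padic_abs p (S n) \<le> 1"
      unfolding padic_integers_def carrier_padic_field by blast
    show "C \<in> ?B"
      using seq_class_mem[OF T(1), of S] S T(2) by (intro image_eqI[of _ _ S]) simp_all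
  next
    fix C assume "C \<in> ?B"
    thus "C \<in> padic_integers p"
      unfolding padic_integers_def carrier_padic_field using seq_class_self by blast
  qed
  thus ?thesis by (auto simp: Zp_def lim_emb_def)
qed

lemma lim_emb_mem_Zp: "padic_Cauchy p S \<Longrightarrow> (\<And>n. padic_abs p (S n) \<le> 1) \<Longrightarrow> lim_emb S \<in> Zp"
  by (auto simp: Zp_eq)

lemma Zp_cases:
  assumes "z \<in> Zp"
  obtains S where "padic_Cauchy p S" "\<And>n. padic_abs p (S n) \<le> 1" "z = lim_emb S"
  using assms unfolding Zp_eq by blast

lemma Qp_cases:
  assumes "z \<in> Qp"
  obtains S where "padic_Cauchy p S" "z = lim_emb S"
  using assms by (auto simp: Qp_eq)

sublocale Zp: field_subring Zp
proof
  show "0 \<in> Zp" using lim_emb_mem_Zp[of "\<lambda>_. 0"] by (simp add: lim_emb_0 padic_Cauchy_const)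
  show "1 \<in> Zp" using lim_emb_mem_Zp[of "\<lambda>_. 1"] by (simp add: lim_emb_1 padic_Cauchy_const)
  fix x assume "x \<in> Zp"
  then obtain S where S: "padic_Cauchy p S" "\<And>n. padic_abs p (S n) \<le> 1" "x = lim_emb S"
    by (rule Zp_cases) blast
  show "- x \<in> Zp" unfolding S(3) lim_emb_uminus[OF S(1), symmetric]
    by (intro lim_emb_mem_Zp padic_Cauchy_minus S) (simp add: S)
  fix y assume "y \<in> Zp"
  then obtain T where T: "padic_Cauchy p T" "\<And>n. padic_abs p (T n) \<le> 1" "y = lim_emb T"
    by (rule Zp_cases) blast
  show "x + y \<in> Zp" unfolding S(3) T(3) lim_emb_add[OF S(1) T(1), symmetric]
    by (intro lim_emb_mem_Zp padic_Cauchy_add prime_p S T order.trans[OF padic_abs_add]) (simp add: S T)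
  show "x * y \<in> Zp" unfolding S(3) T(3) lim_emb_mult[OF S(1) T(1), symmetric]
    by (intro lim_emb_mem_Zp padic_Cauchy_mult prime_p S T)
      (simp add: padic_abs_mult[OF prime_p] mult_le_one S T padic_abs_nonneg)
qed

lemma Zp_subset_Qp: "Zp \<subseteq> Qp"
  by (auto simp: Zp_eq Qp_eq)

lemma of_nat_p_nonzero: "(of_nat p :: 'a) \<noteq> 0"
proof -
  have "\<not> padic_null p (\<lambda>_. of_nat p)"
    unfolding padic_null_def using padic_abs_prime_power[OF prime_p, of 1] p_gt_1
    by (auto intro!: exI[of _ "1 / real p"])
  hence "lim_emb (\<lambda>_. of_nat p) \<noteq> 0" by (intro lim_emb_inverse padic_Cauchy_const)
  thus ?thesis by (simp only: lim_emb_of_nat not_False_eq_True)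
qed

text \<open>One half of the dictionary between bounds on absolute values and divisibility in
  \<open>Zp\<close>; \<open>Zp_power_p_bound\<close> is the other half.\<close>

lemma lim_emb_mem_power_p:
  assumes S: "padic_Cauchy p S" and le: "\<And>n. n \<ge> N \<Longrightarrow> padic_abs p (S n) \<le> 1 / real p ^ k"
  obtains z where "z \<in> Zp" "lim_emb S = of_nat p ^ k * z"
proof -
  \<comment> \<open>\<open>Zp\<close> asks for a representative bounded at every index, so the terms
    before \<open>N\<close> are replaced by 0, which changes the sequence only by a null
    sequence.\<close>
  define T where "T = (\<lambda>n. if n < N then 0 else S n / of_nat p ^ k)"
  have pk: "(of_nat p ^ k :: rat) \<noteq> 0" using prime_p by auto
  have C: "padic_Cauchy p (\<lambda>n. S n * inverse (of_nat p ^ k))"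
    by (intro padic_Cauchy_mult prime_p S padic_Cauchy_const)
  have nullT: "padic_null p (\<lambda>n. T n - S n * inverse (of_nat p ^ k))"
    unfolding padic_null_def by (auto intro!: exI[of _ N] simp: T_def divide_inverse)
  have T: "padic_Cauchy p T"
    using padic_Cauchy_add[OF prime_p padic_null_imp_Cauchy[OF prime_p nullT] C] by simp
  have "lim_emb T \<in> Zp"
  proof (rule lim_emb_mem_Zp[OF T])
    fix n
    show "padic_abs p (T n) \<le> 1"
    proof (cases "n < N")
      case False
      have "padic_abs p (T n) * padic_abs p (of_nat p ^ k) = padic_abs p (S n)"
        using False pk by (simp add: T_def padic_abs_mult[OF prime_p, symmetric])
      thus ?thesis using le[of n] False p_gt_1
        by (simp add: padic_abs_prime_power[OF prime_p] field_simps)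
    qed (simp add: T_def)
  qed
  moreover have "lim_emb S = of_nat p ^ k * lim_emb T"
  proof -
    have "padic_null p (\<lambda>n. S n - of_nat p ^ k * T n)"
      unfolding padic_null_def using pk by (auto intro!: exI[of _ N] simp: T_def)
    hence "lim_emb (\<lambda>n. S n - of_nat p ^ k * T n) = 0" by (rule lim_emb_null)
    thus ?thesis
      by (simp add: lim_emb_diff lim_emb_mult lim_emb_power_p S T padic_Cauchy_const padic_Cauchy_mult prime_p)
  qed
  ultimately show ?thesis using that by blast
qed

lemma Qp_clear_denominator:
  assumes "x \<in> Qp"
  obtains k where "of_nat p ^ k * x \<in> Zp"
proof -
  obtain S where S: "padic_Cauchy p S" "x = lim_emb S" using assms by (rule Qp_cases)
  obtain B where B: "\<And>n. padic_abs p (S n) \<le> B" using padic_Cauchy_bounded[OF prime_p S(1)] by blast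
  obtain k where k: "B < real p ^ k" using real_arch_pow[OF p_gt_1] by blast
  have "lim_emb (\<lambda>n. of_nat p ^ k * S n) \<in> Zp"
  proof (rule lim_emb_mem_Zp)
    show "padic_Cauchy p (\<lambda>n. of_nat p ^ k * S n)"
      by (intro padic_Cauchy_mult prime_p S padic_Cauchy_const)
    show "padic_abs p (of_nat p ^ k * S n) \<le> 1" for n
      using order.trans[OF B[of n] less_imp_le[OF k]] p_gt_1
      by (simp add: padic_abs_mult[OF prime_p] padic_abs_prime_power[OF prime_p] field_simps)
  qed
  thus ?thesis using that S by (simp add: lim_emb_mult lim_emb_power_p padic_Cauchy_const)
qed

text \<open>A late term of a representing sequence fixes the residue: from there on differences are
  below 1 in absolute value, hence at most \<open>1 / p\<close> by
  \<open>padic_abs_lt_1\<close>.\<close>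

lemma Zp_residue:
  assumes "z \<in> Zp"
  obtains a z' where "z' \<in> Zp" "z = of_nat a + of_nat p * z'"
proof -
  obtain S where S: "padic_Cauchy p S" "\<And>n. padic_abs p (S n) \<le> 1" "z = lim_emb S"
    using assms by (rule Zp_cases) blast
  obtain N where N: "\<forall>m\<ge>N. \<forall>n\<ge>N. padic_abs p (S m - S n) < 1"
    using S(1)[unfolded padic_Cauchy_def, THEN spec[of _ 1]] by auto
  obtain a where a: "padic_abs p (S N - of_nat a) \<le> 1 / real p"
    using padic_residue[OF prime_p S(2)] .
  have "padic_abs p (S n - of_nat a) \<le> 1 / real p ^ 1" if "n \<ge> N" for n
    using padic_abs_add[OF prime_p, of "S n - S N" "S N - of_nat a"] a
      padic_abs_lt_1[OF prime_p, of "S n - S N"] N that by simp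
  then obtain z' where "z' \<in> Zp" "lim_emb (\<lambda>n. S n - of_nat a) = of_nat p ^ 1 * z'"
    using lim_emb_mem_power_p[of "\<lambda>n. S n - of_nat a" N 1] S(1) padic_Cauchy_diff padic_Cauchy_const by blast
  thus ?thesis using that[of z' a] S by (simp add: lim_emb_diff lim_emb_of_nat padic_Cauchy_const algebra_simps)
qed

text \<open>All terms \<open>1 + p * T n\<close> have absolute value exactly 1 by the ultrametric
  inequality, so their inverses are again bounded by 1. The elimination in \<open>nakayama\<close>
  divides by such elements.\<close>

lemma Zp_one_plus_p_unit:
  assumes "z \<in> Zp"
  shows "1 + of_nat p * z \<noteq> 0" "inverse (1 + of_nat p * z) \<in> Zp"
proof -
  obtain T where T: "padic_Cauchy p T" "\<And>n. padic_abs p (T n) \<le> 1" "z = lim_emb T"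
    using assms by (rule Zp_cases) blast
  define S where "S = (\<lambda>n. 1 + of_nat p * T n)"
  have S: "padic_Cauchy p S" unfolding S_def
    by (intro padic_Cauchy_add padic_Cauchy_mult prime_p T padic_Cauchy_const)
  have z: "lim_emb S = 1 + of_nat p * z"
    unfolding S_def T(3)
    by (simp add: lim_emb_add lim_emb_mult lim_emb_1 lim_emb_of_nat T padic_Cauchy_const padic_Cauchy_mult prime_p)
  have abs: "padic_abs p (S n) = 1" for n
  proof -
    have "padic_abs p (of_nat p * T n) \<le> 1 / real p"
      using padic_abs_prime_power[OF prime_p, of 1] T(2)[of n] p_gt_1
      by (simp add: padic_abs_mult[OF prime_p] divide_right_mono)
    also have "\<dots> < 1" using p_gt_1 by simp
    finally have lt: "padic_abs p (of_nat p * T n) < 1" .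
    have "padic_abs p (S n) \<le> 1" using padic_abs_add[OF prime_p, of 1 "of_nat p * T n"] lt
      by (simp add: S_def)
    moreover have "1 \<le> max (padic_abs p (S n)) (padic_abs p (of_nat p * T n))"
      using padic_abs_diff[OF prime_p, of "S n" "of_nat p * T n"] by (simp add: S_def)
    ultimately show ?thesis using lt by linarith
  qed
  have nn: "\<not> padic_null p S"
  proof
    assume "padic_null p S"
    then obtain N where "\<forall>n\<ge>N. padic_abs p (S n) < 1"
      unfolding padic_null_def by (rule allE[of _ 1]) auto
    thus False using abs[of N] by auto
  qed
  show "1 + of_nat p * z \<noteq> 0" using lim_emb_inverse(2)[OF S nn] z by simp
  have "padic_abs p (inverse (S n)) = 1" for n
  proof -
    have "S n \<noteq> 0" using abs[of n] by auto
    hence "padic_abs p (S n) * padic_abs p (inverse (S n)) = 1"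
      by (simp add: padic_abs_mult[OF prime_p, symmetric])
    thus ?thesis by (simp add: abs)
  qed
  hence "lim_emb (\<lambda>n. inverse (S n)) \<in> Zp"
    by (intro lim_emb_mem_Zp padic_Cauchy_inverse[OF prime_p S nn]) simp
  thus "inverse (1 + of_nat p * z) \<in> Zp" using lim_emb_inverse(1)[OF S nn] z by simp
qed

lemma Zp_power_p_bound:
  assumes S: "padic_Cauchy p S" and z: "z \<in> Zp" "lim_emb S = of_nat p ^ k * z"
  obtains N where "\<And>n. n \<ge> N \<Longrightarrow> padic_abs p (S n) \<le> 1 / real p ^ k"
proof -
  obtain T where T: "padic_Cauchy p T" "\<And>n. padic_abs p (T n) \<le> 1" "z = lim_emb T"
    using z(1) by (rule Zp_cases) blast
  have pT: "padic_Cauchy p (\<lambda>n. of_nat p ^ k * T n)"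
    by (intro padic_Cauchy_mult prime_p T padic_Cauchy_const)
  have "lim_emb (\<lambda>n. S n - of_nat p ^ k * T n) = 0"
    using z(2) T by (simp add: lim_emb_diff lim_emb_mult lim_emb_power_p S pT padic_Cauchy_const)
  hence "padic_null p (\<lambda>n. S n - of_nat p ^ k * T n)"
    by (simp only: lim_emb_eq_0_iff[OF padic_Cauchy_diff[OF S pT]])
  moreover have "1 / real p ^ k > 0" using p_gt_1 by simp
  ultimately obtain N where N: "\<forall>n\<ge>N. padic_abs p (S n - of_nat p ^ k * T n) < 1 / real p ^ k"
    unfolding padic_null_def by blast
  have "padic_abs p (S n) \<le> 1 / real p ^ k" if "n \<ge> N" for n
  proof -
    have "padic_abs p (of_nat p ^ k * T n) \<le> 1 / real p ^ k"
      using T(2)[of n] p_gt_1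
      by (simp add: padic_abs_mult[OF prime_p] padic_abs_prime_power[OF prime_p] divide_right_mono)
    moreover have "padic_abs p (S n - of_nat p ^ k * T n) < 1 / real p ^ k" using N that by blast
    ultimately show ?thesis
      using padic_abs_add[OF prime_p, of "S n - of_nat p ^ k * T n" "of_nat p ^ k * T n"] by simp
  qed
  thus ?thesis using that by blast
qed

lemma Zp_separated:
  assumes "\<And>k. \<exists>z\<in>Zp. x = of_nat p ^ k * z"
  shows "x = 0"
proof -
  have "x \<in> Zp" using assms[of 0] by auto
  then obtain S where S: "padic_Cauchy p S" "x = lim_emb S" unfolding Zp_eq by blast
  have "padic_null p S"
    unfolding padic_null_def
  proof (intro allI impI)
    fix e :: real assume "e > 0"
    moreover have "1 / real p < 1" using p_gt_1 by simp
    ultimately obtain k where "(1 / real p) ^ k < e"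
      using real_arch_pow_inv by blast
    hence k: "1 / real p ^ k < e" by (simp add: power_divide)
    obtain z where z: "z \<in> Zp" "lim_emb S = of_nat p ^ k * z"
      using assms[of k] unfolding S(2) by blast
    obtain N where "\<And>n. n \<ge> N \<Longrightarrow> padic_abs p (S n) \<le> 1 / real p ^ k"
      using Zp_power_p_bound[OF S(1) z] by blast
    hence "\<forall>n\<ge>N. padic_abs p (S n) < e" using k by (auto intro: le_less_trans)
    thus "\<exists>N. \<forall>n\<ge>N. padic_abs p (S n) < e" ..
  qed
  thus ?thesis using lim_emb_null S by simp
qed

text \<open>Completeness: each term is approximated by a single rational, and these rationals form a Cauchy
  sequence that represents the limit.\<close>

lemma Zp_complete:
  assumes f: "\<And>n. f n \<in> Zp" and step: "\<And>n. \<exists>z\<in>Zp. f (Suc n) - f n = of_nat p ^ n * z"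
  obtains L where "L \<in> Zp" "\<And>n. \<exists>z\<in>Zp. f n - L = of_nat p ^ n * z"
proof -
  have "\<forall>n. \<exists>S. padic_Cauchy p S \<and> f n = lim_emb S"
    using f unfolding Zp_eq by blast
  then obtain S where S: "\<And>n. padic_Cauchy p (S n)" "\<And>n. f n = lim_emb (S n)"
    unfolding choice_iff by blast
  have "\<exists>N. \<forall>m\<ge>N. padic_abs p (S n m - S n N) \<le> 1 / real p ^ n" for n
  proof -
    have "1 / real p ^ n > 0" using p_gt_1 by simp
    with S(1)[of n] obtain N where "\<forall>m\<ge>N. \<forall>j\<ge>N. padic_abs p (S n m - S n j) < 1 / real p ^ n"
      unfolding padic_Cauchy_def by blast
    hence "\<forall>m\<ge>N. padic_abs p (S n m - S n N) \<le> 1 / real p ^ n" by (simp add: less_imp_le)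
    thus ?thesis ..
  qed
  hence "\<forall>n. \<exists>N. \<forall>m\<ge>N. padic_abs p (S n m - S n N) \<le> 1 / real p ^ n" by blast
  then obtain N where N: "\<And>n m. m \<ge> N n \<Longrightarrow> padic_abs p (S n m - S n (N n)) \<le> 1 / real p ^ n"
    unfolding choice_iff by blast
  define q where "q = (\<lambda>n. S n (N n))"
  have approx: "\<exists>z\<in>Zp. f n - lim_emb (\<lambda>_. q n) = of_nat p ^ n * z" for n
  proof -
    have "padic_Cauchy p (\<lambda>m. S n m - q n)" by (intro padic_Cauchy_diff S padic_Cauchy_const)
    then obtain z where "z \<in> Zp" "lim_emb (\<lambda>m. S n m - q n) = of_nat p ^ n * z"
      using lim_emb_mem_power_p[of "\<lambda>m. S n m - q n" "N n" n] N by (auto simp: q_def)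
    thus ?thesis by (auto simp: lim_emb_diff S padic_Cauchy_const)
  qed
  have "padic_abs p (q (Suc n) - q n) \<le> 1 / real p ^ n" for n
  proof -
    obtain a b c where abc: "a \<in> Zp" "b \<in> Zp" "c \<in> Zp"
      "f n - lim_emb (\<lambda>_. q n) = of_nat p ^ n * a"
      "f (Suc n) - lim_emb (\<lambda>_. q (Suc n)) = of_nat p ^ Suc n * b"
      "f (Suc n) - f n = of_nat p ^ n * c"
      using approx[of n] approx[of "Suc n"] step[of n] by blast
    have eq: "lim_emb (\<lambda>_. q (Suc n) - q n) = of_nat p ^ n * (a - of_nat p * b + c)"
    proof -
      have "lim_emb (\<lambda>_. q (Suc n) - q n) = lim_emb (\<lambda>_. q (Suc n)) - lim_emb (\<lambda>_. q n)"
        by (simp add: lim_emb_diff padic_Cauchy_const)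
      also have "\<dots> = (f n - lim_emb (\<lambda>_. q n)) - (f (Suc n) - lim_emb (\<lambda>_. q (Suc n))) + (f (Suc n) - f n)"
        by simp
      finally show ?thesis unfolding abc by (simp add: algebra_simps)
    qed
    have "a - of_nat p * b + c \<in> Zp"
      by (intro Zp.add_mem Zp.diff_mem Zp.mult_mem abc Zp.of_nat_mem)
    from Zp_power_p_bound[OF padic_Cauchy_const this eq] show ?thesis by blast
  qed
  note q = padic_CauchyI_steps[OF prime_p this]
  have lim: "\<exists>z\<in>Zp. f n - lim_emb q = of_nat p ^ n * z" for n
  proof -
    have "padic_Cauchy p (\<lambda>m. q n - q m)" by (intro padic_Cauchy_diff q padic_Cauchy_const)
    moreover have "padic_abs p (q n - q m) \<le> 1 / real p ^ n" if "m \<ge> n" for m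
      unfolding padic_abs_minus_commute[of p "q n"] by (rule q(2)[OF that])
    ultimately obtain z where "z \<in> Zp" "lim_emb (\<lambda>m. q n - q m) = of_nat p ^ n * z"
      by (rule lim_emb_mem_power_p)
    hence z: "z \<in> Zp" "lim_emb (\<lambda>_. q n) - lim_emb q = of_nat p ^ n * z"
      by (auto simp: lim_emb_diff q padic_Cauchy_const)
    obtain z' where z': "z' \<in> Zp" "f n - lim_emb (\<lambda>_. q n) = of_nat p ^ n * z'" using approx by blast
    have "f n - lim_emb q = of_nat p ^ n * (z' + z)"
      using z(2) z'(2) by (simp add: algebra_simps)
    thus ?thesis using Zp.add_mem z z' by blast
  qed
  moreover obtain z where "z \<in> Zp" "f 0 - lim_emb q = z" using lim[of 0] by auto
  hence "lim_emb q \<in> Zp" using f[of 0] Zp.diff_mem[of "f 0" z] by (auto simp: algebra_simps)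
  ultimately show ?thesis using that by blast
qed

end

section \<open>The ring generated by a root of unity\<close>

locale padic_cyclotomic = padic_embedding p emb
  for p :: nat and emb :: "(nat \<Rightarrow> rat) set \<Rightarrow> 'a::field" +
  fixes \<zeta> :: 'a
  assumes p_ge_3: "p \<ge> 3"
    and primitive: "primitive_root_of_unity p \<zeta>"
begin

section \<open>The filtration by powers of \<pi>\<close>

definition \<pi> :: 'a where "\<pi> = \<zeta> - 1"

definition R :: "'a set" where "R = (\<lambda>P. poly P \<pi>) ` Zp.polys"

text \<open>Plays the role of the condition that the \<pi>-adic valuation is at least
  \<open>k\<close>.\<close>

definition E :: "nat \<Rightarrow> 'a set" where "E k = {x. \<exists>r\<in>R. x = \<pi> ^ k * r}"

lemma pi_nonzero [simp]: "\<pi> \<noteq> 0"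
  using primitive p_ge_3 by (auto simp: \<pi>_def primitive_root_of_unity_def dest: spec[of _ 1])

lemma p_nonzero [simp]: "(of_nat p :: 'a) \<noteq> 0"
  by (rule of_nat_p_nonzero)

sublocale R: field_subring R
proof
  show "0 \<in> R" unfolding R_def by (rule image_eqI[of _ _ 0]) (auto intro: Zp.polys_0)
  show "1 \<in> R" unfolding R_def by (rule image_eqI[of _ _ 1]) (auto intro: Zp.polys_1)
  fix x assume "x \<in> R"
  then obtain P where P: "P \<in> Zp.polys" "x = poly P \<pi>" unfolding R_def by blast
  show "- x \<in> R" unfolding R_def
    by (rule image_eqI[of _ _ "- P"]) (auto intro: Zp.polys_uminus P simp: P(2))
  fix y assume "y \<in> R"
  then obtain Q where Q: "Q \<in> Zp.polys" "y = poly Q \<pi>" unfolding R_def by blast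
  show "x + y \<in> R" unfolding R_def
    by (rule image_eqI[of _ _ "P + Q"]) (auto intro: Zp.polys_add P Q simp: P(2) Q(2))
  show "x * y \<in> R" unfolding R_def
    by (rule image_eqI[of _ _ "P * Q"]) (auto intro: Zp.polys_mult P Q simp: P(2) Q(2))
qed

lemma Zp_R: "z \<in> Zp \<Longrightarrow> z \<in> R"
  unfolding R_def by (rule image_eqI[of _ _ "[:z:]"]) (auto intro: Zp.polys_const)

lemma pi_R: "\<pi> \<in> R"
  unfolding R_def by (rule image_eqI[of _ _ "[:0, 1:]"]) (auto intro: Zp.polys_X)

lemmas R_intros = R.add_mem R.diff_mem R.mult_mem R.uminus_mem R.power_mem R.sum_mem
  pi_R R.of_nat_mem R.zero_mem R.one_mem

lemma E_I: "r \<in> R \<Longrightarrow> \<pi> ^ k * r \<in> E k"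
  by (auto simp: E_def)

lemma E_0: "E 0 = R"
  by (auto simp: E_def)

lemma E_zero [simp]: "0 \<in> E k"
  using E_I[OF R.zero_mem] by simp

lemma E_add: "x \<in> E k \<Longrightarrow> y \<in> E k \<Longrightarrow> x + y \<in> E k"
  by (auto simp: E_def distrib_left[symmetric] intro!: R.add_mem)

lemma E_uminus: "x \<in> E k \<Longrightarrow> - x \<in> E k"
proof -
  assume "x \<in> E k"
  then obtain r where "r \<in> R" "x = \<pi> ^ k * r" by (auto simp: E_def)
  thus ?thesis using E_I[of "- r" k] R.uminus_mem by simp
qed

lemma E_diff: "x \<in> E k \<Longrightarrow> y \<in> E k \<Longrightarrow> x - y \<in> E k"
  using E_add[of x k "- y"] E_uminus by simp

lemma E_mult: "x \<in> E k \<Longrightarrow> y \<in> E l \<Longrightarrow> x * y \<in> E (k + l)"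
  unfolding E_def by (force simp: power_add intro: R.mult_mem)

lemma E_mono: "l \<le> k \<Longrightarrow> x \<in> E k \<Longrightarrow> x \<in> E l"
proof -
  assume "l \<le> k" "x \<in> E k"
  then obtain r where r: "r \<in> R" "x = \<pi> ^ k * r" by (auto simp: E_def)
  have "x = \<pi> ^ l * (\<pi> ^ (k - l) * r)"
    using r(2) \<open>l \<le> k\<close> by (simp add: mult.assoc[symmetric] power_add[symmetric])
  thus ?thesis using E_I[of "\<pi> ^ (k - l) * r" l] r(1) by (auto intro: R_intros)
qed

lemma E_R: "x \<in> E k \<Longrightarrow> x \<in> R"
  using E_mono[of 0 k] E_0 by auto

lemma E_mult_R: "x \<in> E k \<Longrightarrow> y \<in> R \<Longrightarrow> x * y \<in> E k"
  using E_mult[of x k y 0] by (simp add: E_0)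

lemma E_mult_R': "y \<in> R \<Longrightarrow> x \<in> E k \<Longrightarrow> y * x \<in> E k"
  using E_mult_R[of x k y] by (simp add: mult.commute)

lemma E_power: "x \<in> E k \<Longrightarrow> x ^ n \<in> E (k * n)"
  by (induction n) (auto intro: E_mult simp: E_0)

lemma E_sum: "(\<And>i. i \<in> I \<Longrightarrow> f i \<in> E k) \<Longrightarrow> sum f I \<in> E k"
  by (induction I rule: infinite_finite_induct) (auto intro: E_add)

lemma E_cancel_power: "\<pi> ^ k * x \<in> E (k + l) \<Longrightarrow> x \<in> E l"
  by (auto simp: E_def power_add mult.assoc)

lemma pi_E: "\<pi> \<in> E 1"
  using E_I[OF R.one_mem, of 1] by simp

subsection \<open>The Eisenstein equation\<close>

text \<open>Expand \<open>(1 + \<pi>) ^ p = 1\<close>, cancel the constant term and one factor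
  \<open>\<pi>\<close>. The relation is used twice: modulo \<open>p\<close> for the Eisenstein
  property, and to reduce polynomials in \<open>\<pi>\<close> in \<open>R_span\<close>.\<close>

lemma pi_power_sum: "\<pi> ^ (p - 1) = - (\<Sum>i<p-1. of_nat (p choose Suc i) * \<pi> ^ i)"
proof -
  have "(1 + \<pi>) ^ p = 1"
    using primitive by (simp add: \<pi>_def primitive_root_of_unity_def)
  moreover have "(1 + \<pi>) ^ p = (\<Sum>k\<le>p. of_nat (p choose k) * \<pi> ^ k)"
    using binomial_ring[of \<pi> 1 p] by (simp add: add.commute)
  moreover have "{..p} = insert 0 (Suc ` {..<p})"
    by (simp only: lessThan_Suc_atMost[symmetric] lessThan_Suc_eq_insert_0)
  hence "(\<Sum>k\<le>p. of_nat (p choose k) * \<pi> ^ k) = 1 + (\<Sum>i<p. of_nat (p choose Suc i) * \<pi> ^ Suc i)"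
    by (simp add: sum.reindex del: power_Suc)
  ultimately have "(\<Sum>i<p. of_nat (p choose Suc i) * \<pi> ^ Suc i) = 0" by simp
  hence "\<pi> * (\<Sum>i<p. of_nat (p choose Suc i) * \<pi> ^ i) = 0"
    by (simp add: sum_distrib_left mult.left_commute)
  hence *: "(\<Sum>i<p. of_nat (p choose Suc i) * \<pi> ^ i) = 0" by simp
  \<comment> \<open>The top summand, split off here, has coefficient \<open>p choose p = 1\<close>,
    so the relation is monic.\<close>
  have "(\<Sum>i<Suc (p - 1). of_nat (p choose Suc i) * \<pi> ^ i) = 0"
    using * p_ge_3 by simp
  hence "(\<Sum>i<p-1. of_nat (p choose Suc i) * \<pi> ^ i) + \<pi> ^ (p - 1) = 0"
    using p_ge_3 by (simp only: sum.lessThan_Suc) simp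
  thus ?thesis by (simp add: eq_neg_iff_add_eq_0 add.commute)
qed

lemma p_dvd_choose:
  assumes "0 < k" "k < p"
  shows "p dvd (p choose k)"
proof -
  have "k * (p choose k) = p * ((p - 1) choose (k - 1))"
    by (rule times_binomial_minus1_eq[OF assms(1)])
  hence "p dvd k * (p choose k)" by simp
  thus ?thesis using prime_p assms by (auto simp: prime_dvd_mult_iff dest: dvd_imp_le)
qed

text \<open>The lowest coefficient divided by \<open>p\<close> is
  \<open>(p choose 1) div p = 1\<close>. Knowing this residue exactly is what makes the terms of
  index 1 and \<open>p\<close> cancel in \<open>log_terms_1_p_E\<close>.\<close>

lemma pi_power_eisenstein:
  obtains g where "g \<in> R" "\<pi> ^ (p - 1) = - of_nat p * (1 + \<pi> * g)"
proof -
  define c where "c = (\<lambda>i. (p choose Suc i) div p)"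
  have c: "p choose Suc i = p * c i" if "i < p - 1" for i
    using p_dvd_choose[of "Suc i"] that by (simp add: c_def)
  have "\<pi> ^ (p - 1) = - (\<Sum>i<p-1. of_nat p * (of_nat (c i) * \<pi> ^ i))"
    unfolding pi_power_sum using c by (simp add: mult.assoc)
  also have "\<dots> = - of_nat p * (\<Sum>i<p-1. of_nat (c i) * \<pi> ^ i)"
    by (simp add: sum_distrib_left sum_negf)
  also have "(\<Sum>i<p-1. of_nat (c i) * \<pi> ^ i) = (\<Sum>i<Suc (p-2). of_nat (c i) * \<pi> ^ i)"
    using p_ge_3 by (intro sum.cong) auto
  also have "\<dots> = of_nat (c 0) + \<pi> * (\<Sum>i<p-2. of_nat (c (Suc i)) * \<pi> ^ i)"
    by (simp only: sum.lessThan_Suc_shift) (simp add: sum_distrib_left mult.left_commute)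
  also have "c 0 = 1" using p_ge_3 by (simp add: c_def)
  finally show ?thesis
    by (intro that[of "\<Sum>i<p-2. of_nat (c (Suc i)) * \<pi> ^ i"]) (auto intro!: R_intros)
qed

text \<open>The Eisenstein relation only shows that \<open>p\<close> divides
  \<open>\<pi> ^ (p - 1)\<close>. The converse is bootstrapped: if \<open>p\<close> lies in
  \<open>E k\<close> with \<open>k < p - 1\<close>, then
  \<open>p = - \<pi> ^ (p - 1) - p * \<pi> * g\<close> lies in \<open>E (k + 1)\<close>. Comparing
  both divisibilities exhibits the inverse of \<open>\<epsilon>\<close>.\<close>

lemma p_eq_pi_power:
  obtains \<epsilon> \<epsilon>' where "\<epsilon> \<in> R" "\<epsilon>' \<in> R" "\<epsilon> * \<epsilon>' = 1" "of_nat p = \<pi> ^ (p - 1) * \<epsilon>"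
proof -
  obtain g where g: "g \<in> R" "\<pi> ^ (p - 1) = - of_nat p * (1 + \<pi> * g)" by (rule pi_power_eisenstein)
  have "k \<le> p - 1 \<Longrightarrow> of_nat p \<in> E k" for k
  proof (induction k)
    case (Suc k)
    hence pk: "of_nat p \<in> E k" by simp
    have "of_nat p = - (\<pi> ^ (p - 1)) - of_nat p * \<pi> * g" unfolding g(2) by (simp add: algebra_simps)
    also have "\<dots> \<in> E (Suc k)"
    proof (rule E_diff)
      have "\<pi> ^ (p - 1) \<in> E (p - 1)" using E_I[OF R.one_mem] by simp
      thus "- (\<pi> ^ (p - 1)) \<in> E (Suc k)" using Suc.prems by (intro E_uminus) (rule E_mono)
      show "of_nat p * \<pi> * g \<in> E (Suc k)"
        using E_mult_R[OF E_mult[OF pk pi_E] g(1)] by simp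
    qed
    finally show ?case .
  qed (simp add: E_0)
  from this[OF order_refl] obtain \<epsilon> where \<epsilon>: "\<epsilon> \<in> R" "of_nat p = \<pi> ^ (p - 1) * \<epsilon>"
    by (auto simp: E_def)
  have "\<pi> ^ (p - 1) * (\<epsilon> * - (1 + \<pi> * g)) = - (\<pi> ^ (p - 1) * \<epsilon>) * (1 + \<pi> * g)"
    by (simp add: algebra_simps)
  also have "\<dots> = \<pi> ^ (p - 1) * 1" unfolding \<epsilon>(2)[symmetric] g(2)[symmetric] by simp
  finally have "\<epsilon> * - (1 + \<pi> * g) = 1"
    by (rule mult_left_cancel[THEN iffD1, rotated]) simp
  thus ?thesis using g \<epsilon>
    by (intro that[of \<epsilon> "- (1 + \<pi> * g)"]) (auto intro!: R_intros)
qed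

text \<open>Since \<open>p\<close> is \<open>\<pi> ^ (p - 1)\<close> times a unit, multiplication by
  \<open>p ^ k\<close> shifts the filtration exactly. As \<open>x\<close> ranges over the ambient
  field, this also controls division by \<open>p\<close>.\<close>

lemma p_power_E: "of_nat p ^ k * x \<in> E ((p - 1) * k + l) \<longleftrightarrow> x \<in> E l"
proof -
  obtain \<epsilon> \<epsilon>' where e: "\<epsilon> \<in> R" "\<epsilon>' \<in> R" "\<epsilon> * \<epsilon>' = 1" "of_nat p = \<pi> ^ (p - 1) * \<epsilon>"
    by (rule p_eq_pi_power)
  have eq: "of_nat p ^ k * x = \<pi> ^ ((p - 1) * k) * (\<epsilon> ^ k * x)"
    unfolding e(4) by (simp add: power_mult power_mult_distrib mult.assoc)
  have "\<epsilon>' ^ k * (\<epsilon> ^ k * x) = (\<epsilon> * \<epsilon>') ^ k * x"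
    by (simp add: power_mult_distrib)
  hence cancel: "\<epsilon>' ^ k * (\<epsilon> ^ k * x) = x"
    by (simp add: e(3))
  have "\<epsilon> ^ k * x \<in> E l \<longleftrightarrow> x \<in> E l"
    using E_mult_R'[OF R.power_mem[OF e(2)], of "\<epsilon> ^ k * x" l k]
      E_mult_R'[OF R.power_mem[OF e(1)], of x l k] unfolding cancel by blast
  moreover have "\<pi> ^ ((p - 1) * k) * (\<epsilon> ^ k * x) \<in> E ((p - 1) * k + l) \<longleftrightarrow> \<epsilon> ^ k * x \<in> E l"
    using E_cancel_power E_mult[OF E_I[OF R.one_mem, of "(p - 1) * k"], of "\<epsilon> ^ k * x" l] by auto
  ultimately show ?thesis unfolding eq by blast
qed

lemma E_p_power: "x \<in> E ((p - 1) * k) \<longleftrightarrow> (\<exists>r\<in>R. x = of_nat p ^ k * r)"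
proof
  assume x: "x \<in> E ((p - 1) * k)"
  have "x = of_nat p ^ k * (x / of_nat p ^ k)" by simp
  moreover have "x / of_nat p ^ k \<in> R"
    using p_power_E[of k "x / of_nat p ^ k" 0] x by (simp add: E_0)
  ultimately show "\<exists>r\<in>R. x = of_nat p ^ k * r" by blast
next
  assume "\<exists>r\<in>R. x = of_nat p ^ k * r"
  thus "x \<in> E ((p - 1) * k)" using p_power_E[of k _ 0] by (auto simp: E_0)
qed

lemma p_E: "of_nat p \<in> E (p - 1)"
  using E_p_power[of "of_nat p" 1] R.one_mem by force

subsection \<open>Finite generation and the Nakayama argument\<close>

text \<open>Horner's scheme: multiplication by \<open>\<pi>\<close> shifts the coefficients, and the
  overflow at \<open>\<pi> ^ (p - 1)\<close> is folded back by \<open>pi_power_sum\<close>.\<close>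

lemma R_span:
  assumes "r \<in> R"
  obtains a where "\<And>i. a i \<in> Zp" "r = (\<Sum>i<p-1. a i * \<pi> ^ i)"
proof -
  define m where "m = p - 2"
  have m: "p - 1 = Suc m" using p_ge_3 by (simp add: m_def)
  have "\<exists>a. (\<forall>i. a i \<in> Zp) \<and> poly P \<pi> = (\<Sum>i<Suc m. a i * \<pi> ^ i)" if "P \<in> Zp.polys" for P
    using that
  proof (induction P)
    case 0
    show ?case by (intro exI[of _ "\<lambda>_. 0"]) simp
  next
    case (pCons c P)
    have "c \<in> Zp" "P \<in> Zp.polys" using Zp.polys_pConsD[OF pCons.prems] by blast+
    then obtain a where a: "\<And>i. a i \<in> Zp" "poly P \<pi> = (\<Sum>i<Suc m. a i * \<pi> ^ i)"
      using pCons.IH by blast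
    define b where "b = (\<lambda>i. (case i of 0 \<Rightarrow> c | Suc j \<Rightarrow> a j) - a m * of_nat (p choose Suc i))"
    have "poly (pCons c P) \<pi> = c + (\<Sum>i<Suc m. a i * \<pi> ^ Suc i)"
      by (simp add: a(2) sum_distrib_left distrib_left mult_ac)
    also have "\<dots> = (c + (\<Sum>i<m. a i * \<pi> ^ Suc i)) + a m * \<pi> ^ (p - 1)"
      by (simp only: m sum.lessThan_Suc add.assoc)
    also have "c + (\<Sum>i<m. a i * \<pi> ^ Suc i) = (\<Sum>i<Suc m. (case i of 0 \<Rightarrow> c | Suc j \<Rightarrow> a j) * \<pi> ^ i)"
      by (simp only: sum.lessThan_Suc_shift) simp
    also have "\<dots> + a m * \<pi> ^ (p - 1) = (\<Sum>i<Suc m. b i * \<pi> ^ i)"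
      unfolding pi_power_sum unfolding m b_def
      by (simp add: left_diff_distrib sum_subtractf sum_distrib_left mult.assoc del: sum.lessThan_Suc)
    finally have "poly (pCons c P) \<pi> = (\<Sum>i<Suc m. b i * \<pi> ^ i)" .
    moreover have "b i \<in> Zp" for i
      unfolding b_def by (intro Zp.diff_mem Zp.mult_mem Zp.of_nat_mem a(1))
        (cases i, simp_all add: a(1) \<open>c \<in> Zp\<close>)
    ultimately show ?case by blast
  qed
  moreover obtain P where "P \<in> Zp.polys" "r = poly P \<pi>" using assms by (auto simp: R_def)
  ultimately obtain a where "\<forall>i. a i \<in> Zp" "r = (\<Sum>i<p-1. a i * \<pi> ^ i)" unfolding m by blast
  thus ?thesis by (intro that) blast+
qed

text \<open>Nakayama's lemma for the module \<open>R / x R\<close>: the generators \<open>\<pi> ^ i\<close> are eliminated one at a time,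
  starting from the last.\<close>

lemma nakayama:
  assumes x: "x \<in> R" and st: "s \<in> R" "t \<in> R" "1 = x * s + of_nat p * t"
  shows "\<exists>u\<in>R. x * u = 1"
proof -
  have "\<forall>r\<in>R. \<exists>u\<in>R. \<exists>a. (\<forall>i. a i \<in> Zp) \<and> r = x * u + (\<Sum>i<k. a i * \<pi> ^ i)" if "k \<le> p - 1" for k
    using that
  proof (induction k rule: inc_induct)
    case base
    show ?case
    proof
      fix r assume "r \<in> R"
      then obtain a where "\<And>i. a i \<in> Zp" "r = (\<Sum>i<p-1. a i * \<pi> ^ i)" by (rule R_span) blast
      thus "\<exists>u\<in>R. \<exists>a. (\<forall>i. a i \<in> Zp) \<and> r = x * u + (\<Sum>i<p-1. a i * \<pi> ^ i)"
        by (intro bexI[of _ 0] exI[of _ a]) auto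
    qed
  next
    case (step k)
    have "\<pi> ^ k * t \<in> R" by (intro R_intros st)
    with step.IH obtain u a where u: "u \<in> R" "\<And>i. a i \<in> Zp"
      "\<pi> ^ k * t = x * u + (\<Sum>i<Suc k. a i * \<pi> ^ i)" by blast
    \<comment> \<open>Multiply \<open>1 = x * s + p * t\<close> by \<open>\<pi> ^ k\<close>:
      expanding \<open>\<pi> ^ k * t\<close> brings back \<open>\<pi> ^ k\<close> with coefficient
      \<open>p * a k\<close>. Moved to the left, this leaves the factor \<open>w\<close>, a unit of
      \<open>Zp\<close>, so \<open>\<pi> ^ k\<close> can be solved for.\<close>
    define w where "w = 1 + of_nat p * (- a k)"
    have w: "w \<noteq> 0" "inverse w \<in> Zp"
      unfolding w_def using Zp_one_plus_p_unit[of "- a k"] u(2) Zp.uminus_mem by blast+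
    have "\<pi> ^ k = \<pi> ^ k * (x * s + of_nat p * t)" using st(3) by simp
    also have "\<dots> = x * (\<pi> ^ k * s) + of_nat p * (\<pi> ^ k * t)" by (simp add: algebra_simps)
    also have "\<dots> = x * (\<pi> ^ k * s + of_nat p * u) + of_nat p * (\<Sum>i<k. a i * \<pi> ^ i) + of_nat p * a k * \<pi> ^ k"
      unfolding u(3) by (simp add: algebra_simps)
    finally have "w * \<pi> ^ k = x * (\<pi> ^ k * s + of_nat p * u) + of_nat p * (\<Sum>i<k. a i * \<pi> ^ i)"
      unfolding w_def by (simp add: algebra_simps)
    moreover have "\<pi> ^ k = inverse w * (w * \<pi> ^ k)" using w(1) by simp
    ultimately have pk: "\<pi> ^ k = inverse w * (x * (\<pi> ^ k * s + of_nat p * u) + of_nat p * (\<Sum>i<k. a i * \<pi> ^ i))"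
      by simp
    show ?case
    proof
      fix r assume "r \<in> R"
      with step.IH obtain v b where v: "v \<in> R" "\<And>i. b i \<in> Zp"
        "r = x * v + (\<Sum>i<Suc k. b i * \<pi> ^ i)" by blast
      have "b k * \<pi> ^ k = b k * (inverse w * (x * (\<pi> ^ k * s + of_nat p * u) + of_nat p * (\<Sum>i<k. a i * \<pi> ^ i)))"
        by (rule arg_cong[OF pk])
      hence "r = x * v + (\<Sum>i<k. b i * \<pi> ^ i)
          + b k * (inverse w * (x * (\<pi> ^ k * s + of_nat p * u) + of_nat p * (\<Sum>i<k. a i * \<pi> ^ i)))"
        using v(3) by (simp only: sum.lessThan_Suc add.assoc)
      also have "\<dots> = x * (v + b k * inverse w * (\<pi> ^ k * s + of_nat p * u))
          + (\<Sum>i<k. (b i + b k * inverse w * of_nat p * a i) * \<pi> ^ i)"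
        by (simp add: algebra_simps sum.distrib sum_distrib_left)
      finally show "\<exists>u\<in>R. \<exists>a. (\<forall>i. a i \<in> Zp) \<and> r = x * u + (\<Sum>i<k. a i * \<pi> ^ i)"
        by (intro bexI[of _ "v + b k * inverse w * (\<pi> ^ k * s + of_nat p * u)"]
            exI[of _ "\<lambda>i. b i + b k * inverse w * of_nat p * a i"] conjI allI)
          (auto intro!: R_intros Zp.add_mem Zp.mult_mem Zp_R[OF v(2)] Zp_R[OF w(2)] u v w(2) st)
    qed
  qed
  from this[of 0] R.one_mem show ?thesis by (metis le0 lessThan_0 sum.empty add.right_neutral)
qed

text \<open>Nakayama at \<open>x = 0\<close>: if \<open>p\<close> were invertible in
  \<open>R\<close>, then 0 would be.\<close>

lemma p_not_unit: "t \<in> R \<Longrightarrow> of_nat p * t \<noteq> 1"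
  using nakayama[of 0 0 t] by auto

lemma one_not_E: "1 \<notin> E 1"
proof
  assume "1 \<in> E 1"
  hence "1 \<in> E (1 * (p - 1))" using E_power[of 1 1 "p - 1"] by simp
  then obtain r where "r \<in> R" "1 = of_nat p ^ 1 * r" using E_p_power[of 1 1] by auto
  thus False using p_not_unit[of r] by simp
qed

lemma R_residue:
  assumes "r \<in> R"
  obtains a r' where "r' \<in> R" "r = of_nat a + \<pi> * r'"
proof -
  obtain P where P: "P \<in> Zp.polys" "r = poly P \<pi>" using assms by (auto simp: R_def)
  obtain c Q where PQ: "P = pCons c Q" by (cases P)
  have "c \<in> Zp" "Q \<in> Zp.polys" using Zp.polys_pConsD[OF P(1)[unfolded PQ]] by blast+
  then obtain a z where z: "z \<in> Zp" "c = of_nat a + of_nat p * z" using Zp_residue by blast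
  have "poly Q \<pi> \<in> R" using \<open>Q \<in> Zp.polys\<close> by (auto simp: R_def)
  have "of_nat p \<in> E 1" using E_mono[OF _ p_E, of 1] p_ge_3 by simp
  then obtain q where q: "q \<in> R" "of_nat p = \<pi> * q" by (auto simp: E_def)
  have "r = of_nat a + \<pi> * (q * z + poly Q \<pi>)"
    by (simp add: P(2) PQ z(2) q(2) algebra_simps)
  moreover have "q * z + poly Q \<pi> \<in> R"
    by (intro R_intros q Zp_R[OF z(1)] \<open>poly Q \<pi> \<in> R\<close>)
  ultimately show ?thesis by (intro that)
qed

lemma of_nat_inverse_mod_E:
  assumes "\<not> p dvd a"
  obtains b where "1 - of_nat a * of_nat b \<in> E 1"
proof -
  have "coprime a p" using assms prime_p by (metis coprime_commute prime_imp_coprime)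
  then obtain b where "[a * b = Suc 0] (mod p)" using cong_solve_coprime_nat by blast
  moreover have "1 < p" using p_ge_3 by simp
  ultimately have "a * b mod p = 1" by (simp add: Cong.cong_def)
  hence "a * b = 1 + p * (a * b div p)" using mod_mult_div_eq[of "a * b" p] by simp
  hence "of_nat a * of_nat b = (1 + of_nat p * of_nat (a * b div p) :: 'a)"
    by (metis of_nat_mult of_nat_add of_nat_1)
  hence "1 - of_nat a * of_nat b = (- (of_nat p * of_nat (a * b div p)) :: 'a)"
    by (simp only:) simp
  also have "\<dots> \<in> E 1"
    using E_mono[OF _ p_E, of 1] p_ge_3 by (intro E_uminus E_mult_R R.of_nat_mem) auto
  finally show ?thesis by (rule that)
qed

lemma of_nat_E_1_iff: "of_nat a \<in> E 1 \<longleftrightarrow> p dvd a"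
proof
  assume "p dvd a"
  then obtain b where "a = p * b" by auto
  moreover have "of_nat p \<in> E 1" using E_mono[OF _ p_E, of 1] p_ge_3 by simp
  ultimately show "of_nat a \<in> E 1" by (auto intro: E_mult_R)
next
  assume a: "of_nat a \<in> E 1"
  show "p dvd a"
  proof (rule ccontr)
    assume "\<not> p dvd a"
    then obtain b where "1 - of_nat a * of_nat b \<in> E 1" by (rule of_nat_inverse_mod_E)
    moreover have "of_nat a * of_nat b \<in> E 1" using a by (rule E_mult_R) (rule R.of_nat_mem)
    ultimately have "(1 - of_nat a * of_nat b) + of_nat a * of_nat b \<in> E 1" by (rule E_add)
    thus False using one_not_E by simp
  qed
qed

text \<open>An inverse \<open>b\<close> modulo \<open>\<pi>\<close> leaves the error
  \<open>d = 1 - r * b\<close>. Iteration gives \<open>1 = r * s + d ^ k\<close>; at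
  \<open>k = p - 1\<close> the error is divisible by \<open>p\<close>, and \<open>nakayama\<close>
  yields an exact inverse.\<close>

lemma R_unit:
  assumes r: "r \<in> R" "r \<notin> E 1"
  shows "\<exists>s\<in>R. r * s = 1"
proof -
  obtain a r' where ar: "r' \<in> R" "r = of_nat a + \<pi> * r'" using r(1) by (rule R_residue)
  have piE: "\<pi> * y \<in> E 1" if "y \<in> R" for y using E_mult_R[OF pi_E that] .
  have "\<not> p dvd a"
  proof
    assume "p dvd a"
    hence "r \<in> E 1" unfolding ar(2) by (intro E_add piE ar of_nat_E_1_iff[THEN iffD2])
    thus False using r(2) by blast
  qed
  then obtain b where b: "1 - of_nat a * of_nat b \<in> E 1" by (rule of_nat_inverse_mod_E)
  define d where "d = 1 - r * of_nat b"
  have d: "d \<in> E 1"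
  proof -
    have "d = (1 - of_nat a * of_nat b) - \<pi> * (r' * of_nat b)"
      by (simp add: d_def ar(2) algebra_simps)
    thus ?thesis by (simp only:) (intro E_diff b piE R_intros ar)
  qed
  have "\<exists>s\<in>R. 1 = r * s + d ^ k" for k
  proof (induction k)
    case (Suc k)
    then obtain s where s: "s \<in> R" "1 = r * s + d ^ k" by blast
    have "1 = r * of_nat b + d * (r * s + d ^ k)" unfolding s(2)[symmetric] by (simp add: d_def)
    also have "\<dots> = r * (of_nat b + d * s) + d ^ Suc k" by (simp add: algebra_simps)
    finally show ?case using s(1) E_R[OF d] by (intro bexI[of _ "of_nat b + d * s"]) (auto intro: R_intros)
  qed (auto intro: bexI[of _ 0])
  then obtain s where s: "s \<in> R" "1 = r * s + d ^ (p - 1)" by blast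
  moreover have "d ^ (p - 1) \<in> E ((p - 1) * 1)" using E_power[OF d, of "p - 1"] by simp
  then obtain t where "t \<in> R" "d ^ (p - 1) = of_nat p ^ 1 * t" unfolding E_p_power by blast
  ultimately show ?thesis using nakayama[OF r(1), of s t] by simp
qed

subsection \<open>Separatedness and completeness\<close>

text \<open>The powers of \<open>\<pi>\<close> below \<open>p - 1\<close> have distinct orders. By
  induction the lower coefficients are divisible by \<open>p\<close>, the higher terms by
  \<open>\<pi> ^ (i + 1)\<close>, so \<open>a i\<close> lies in \<open>E 1\<close>, which meets
  \<open>Zp\<close> in the multiples of \<open>p\<close>.\<close>

lemma coefficients_divisible:
  assumes a: "\<And>i. a i \<in> Zp" and E: "(\<Sum>i<p-1. a i * \<pi> ^ i) \<in> E (p - 1)" and i: "i < p - 1"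
  shows "\<exists>z\<in>Zp. a i = of_nat p * z"
  using i
proof (induction i rule: less_induct)
  case (less i)
  have "{..<p-1} = {..<i} \<union> insert i {i<..<p-1}" using less.prems by auto
  hence "(\<Sum>j<p-1. a j * \<pi> ^ j) = (\<Sum>j\<in>{..<i} \<union> insert i {i<..<p-1}. a j * \<pi> ^ j)"
    by (rule arg_cong)
  also have "\<dots> = (\<Sum>j<i. a j * \<pi> ^ j) + (\<Sum>j\<in>insert i {i<..<p-1}. a j * \<pi> ^ j)"
    by (rule sum.union_disjoint) auto
  finally have eq: "\<pi> ^ i * a i = (\<Sum>j<p-1. a j * \<pi> ^ j) - (\<Sum>j<i. a j * \<pi> ^ j) - (\<Sum>j\<in>{i<..<p-1}. a j * \<pi> ^ j)"
    by (simp add: algebra_simps)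
  have total: "(\<Sum>j<p-1. a j * \<pi> ^ j) \<in> E (i + 1)"
    using less.prems by (intro E_mono[OF _ E]) simp
  have lower: "(\<Sum>j<i. a j * \<pi> ^ j) \<in> E (i + 1)"
  proof (rule E_sum)
    fix j assume "j \<in> {..<i}"
    then obtain z where z: "z \<in> Zp" "a j = of_nat p * z"
      using less.IH[of j] less.prems by auto
    have "of_nat p * z * \<pi> ^ j \<in> E (p - 1)"
      by (intro E_mult_R p_E R_intros Zp_R z)
    thus "a j * \<pi> ^ j \<in> E (i + 1)" unfolding z(2) using less.prems by (intro E_mono[of "i + 1" "p - 1"]) auto
  qed
  have upper: "(\<Sum>j\<in>{i<..<p-1}. a j * \<pi> ^ j) \<in> E (i + 1)"
  proof (rule E_sum)
    fix j assume "j \<in> {i<..<p-1}"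
    hence "\<pi> ^ j * a j \<in> E (i + 1)" using a by (intro E_mono[OF _ E_I] Zp_R) auto
    thus "a j * \<pi> ^ j \<in> E (i + 1)" by (simp add: mult.commute)
  qed
  have "\<pi> ^ i * a i \<in> E (i + 1)"
    unfolding eq by (rule E_diff[OF E_diff[OF total lower] upper])
  hence ai: "a i \<in> E 1" by (rule E_cancel_power)
  obtain c z where z: "z \<in> Zp" "a i = of_nat c + of_nat p * z"
    using a[of i] by (rule Zp_residue)
  have "of_nat p * z \<in> E 1" using E_mono[OF _ p_E, of 1] p_ge_3 z(1) by (intro E_mult_R Zp_R) auto
  hence "of_nat c \<in> E 1" using E_diff[OF ai, of "of_nat p * z"] by (simp add: z(2))
  hence "p dvd c" by (rule of_nat_E_1_iff[THEN iffD1])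
  then obtain b where "c = p * b" by (rule dvdE)
  hence "a i = of_nat p * (of_nat b + z)" by (simp add: z(2) algebra_simps)
  thus ?case using Zp.add_mem[OF Zp.of_nat_mem z(1)] by blast
qed

lemma coefficients_divisible_power:
  assumes "\<And>i. a i \<in> Zp" "r \<in> R" "(\<Sum>i<p-1. a i * \<pi> ^ i) = of_nat p ^ n * r" "i < p - 1"
  shows "\<exists>z\<in>Zp. a i = of_nat p ^ n * z"
  using assms
proof (induction n arbitrary: a)
  case (Suc n)
  have "of_nat p * (of_nat p ^ n * r) \<in> E (p - 1)" by (intro E_mult_R p_E R_intros Suc.prems)
  hence "(\<Sum>i<p-1. a i * \<pi> ^ i) \<in> E (p - 1)" using Suc.prems(3) by (simp add: mult.assoc)
  hence "\<forall>i. \<exists>z. z \<in> Zp \<and> (i < p - 1 \<longrightarrow> a i = of_nat p * z)"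
    using coefficients_divisible[where a = a, OF Suc.prems(1)] Zp.zero_mem by blast
  then obtain b where b: "\<And>i. b i \<in> Zp" "\<And>i. i < p - 1 \<Longrightarrow> a i = of_nat p * b i"
    unfolding choice_iff by blast
  have "of_nat p * (\<Sum>i<p-1. b i * \<pi> ^ i) = of_nat p * (of_nat p ^ n * r)"
    using Suc.prems(3) b(2) by (simp add: sum_distrib_left mult.assoc)
  hence "(\<Sum>i<p-1. b i * \<pi> ^ i) = of_nat p ^ n * r" by simp
  then obtain z where "z \<in> Zp" "b i = of_nat p ^ n * z"
    using Suc.IH[where a = b, OF b(1) Suc.prems(2) _ Suc.prems(4)] by blast
  thus ?case using b(2)[OF Suc.prems(4)] by (auto simp: mult.assoc)
qed auto

lemma E_separated:
  assumes "\<And>k. x \<in> E k"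
  shows "x = 0"
proof -
  have "x \<in> R" using assms[of 0] by (simp add: E_0)
  then obtain a where a: "\<And>i. a i \<in> Zp" "x = (\<Sum>i<p-1. a i * \<pi> ^ i)" by (rule R_span) blast
  have "a i = 0" if "i < p - 1" for i
  proof (rule Zp_separated)
    fix n
    obtain r where "r \<in> R" "x = of_nat p ^ n * r" using assms E_p_power by blast
    thus "\<exists>z\<in>Zp. a i = of_nat p ^ n * z"
      using coefficients_divisible_power[where a = a and r = r and n = n, OF a(1) _ _ that] a(2) by simp
  qed
  thus ?thesis using a(2) by simp
qed

lemma R_complete_p:
  assumes f: "\<And>n. f n \<in> R" and step: "\<And>n. f (Suc n) - f n \<in> E ((p - 1) * n)"
  obtains L where "\<And>n. f n - L \<in> E ((p - 1) * n)"
proof -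
  have "\<exists>b. (\<forall>i. b i \<in> Zp) \<and> f (Suc n) - f n = of_nat p ^ n * (\<Sum>i<p-1. b i * \<pi> ^ i)" for n
  proof -
    obtain r where r: "r \<in> R" "f (Suc n) - f n = of_nat p ^ n * r" using step E_p_power by blast
    from r(1) obtain b where "\<And>i. b i \<in> Zp" "r = (\<Sum>i<p-1. b i * \<pi> ^ i)" by (rule R_span) blast
    thus ?thesis using r(2) by blast
  qed
  hence "\<forall>n. \<exists>b. (\<forall>i. b i \<in> Zp) \<and> f (Suc n) - f n = of_nat p ^ n * (\<Sum>i<p-1. b i * \<pi> ^ i)" by blast
  then obtain b where b: "\<And>n i. b n i \<in> Zp"
    "\<And>n. f (Suc n) - f n = of_nat p ^ n * (\<Sum>i<p-1. b n i * \<pi> ^ i)"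
    unfolding choice_iff by blast
  obtain a where a: "\<And>i. a i \<in> Zp" "f 0 = (\<Sum>i<p-1. a i * \<pi> ^ i)" using f[of 0] by (rule R_span) blast
  \<comment> \<open>Coordinates are chosen for \<open>f 0\<close> and for each increment and then
    added up, so consecutive values differ by \<open>p ^ n * b n i\<close> and
    \<open>Zp_complete\<close> applies to each coordinate.\<close>
  define F where "F = (\<lambda>i n. a i + (\<Sum>m<n. of_nat p ^ m * b m i))"
  have F: "F i n \<in> Zp" for i n
    unfolding F_def by (intro Zp.add_mem Zp.sum_mem Zp.mult_mem Zp.power_mem Zp.of_nat_mem a b)
  have fF: "f n = (\<Sum>i<p-1. F i n * \<pi> ^ i)" for n
  proof (induction n)
    case 0 thus ?case using a(2) by (simp add: F_def)
  next
    case (Suc n)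
    have "f (Suc n) = (\<Sum>i<p-1. F i n * \<pi> ^ i) + of_nat p ^ n * (\<Sum>i<p-1. b n i * \<pi> ^ i)"
      using b(2)[of n] Suc.IH by (simp add: algebra_simps)
    also have "\<dots> = (\<Sum>i<p-1. F i (Suc n) * \<pi> ^ i)"
      by (simp add: F_def sum_distrib_left sum.distrib[symmetric] algebra_simps)
    finally show ?case .
  qed
  have "\<exists>l. \<forall>n. \<exists>z\<in>Zp. F i n - l = of_nat p ^ n * z" for i
  proof -
    have "\<exists>z\<in>Zp. F i (Suc n) - F i n = of_nat p ^ n * z" for n
      using b(1) by (intro bexI[of _ "b n i"]) (auto simp: F_def)
    from Zp_complete[OF F this] show ?thesis by blast
  qed
  hence "\<forall>i. \<exists>l. \<forall>n. \<exists>z\<in>Zp. F i n - l = of_nat p ^ n * z" by blast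
  then obtain l where l: "\<And>i n. \<exists>z\<in>Zp. F i n - l i = of_nat p ^ n * z" unfolding choice_iff by blast
  have "f n - (\<Sum>i<p-1. l i * \<pi> ^ i) \<in> E ((p - 1) * n)" for n
  proof -
    have "f n - (\<Sum>i<p-1. l i * \<pi> ^ i) = (\<Sum>i<p-1. (F i n - l i) * \<pi> ^ i)"
      by (simp add: fF sum_subtractf left_diff_distrib)
    also have "\<dots> \<in> E ((p - 1) * n)"
    proof (rule E_sum)
      fix i
      obtain z where "z \<in> Zp" "F i n - l i = of_nat p ^ n * z" using l by blast
      hence "F i n - l i \<in> E ((p - 1) * n)" unfolding E_p_power using Zp_R by blast
      thus "(F i n - l i) * \<pi> ^ i \<in> E ((p - 1) * n)" by (intro E_mult_R R_intros)
    qed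
    finally show ?thesis .
  qed
  thus ?thesis by (rule that)
qed

lemma E_steps:
  assumes "\<And>n. f (Suc n) - f n \<in> E n" "k \<le> m" "k \<le> n"
  shows "f m - f n \<in> E k"
proof -
  have *: "f m - f k \<in> E k" if "k \<le> m" for m
    using that
  proof (induction m rule: dec_induct)
    case (step m)
    have "f (Suc m) - f k = (f (Suc m) - f m) + (f m - f k)" by simp
    also have "\<dots> \<in> E k" using assms(1) step by (intro E_add E_mono[OF _ assms(1)]) auto
    finally show ?case .
  qed simp
  have "f m - f n = (f m - f k) - (f n - f k)" by simp
  also have "\<dots> \<in> E k" by (rule E_diff[OF *[OF assms(2)] *[OF assms(3)]])
  finally show ?thesis .
qed

lemma R_complete:
  assumes f: "\<And>n. f n \<in> R" and step: "\<And>n. f (Suc n) - f n \<in> E n"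
  obtains L where "L \<in> R" "\<And>n. f n - L \<in> E n"
proof -
  \<comment> \<open>The steps gain one power of \<open>\<pi>\<close> at a time; along multiples of
    \<open>p - 1\<close> they gain one power of \<open>p\<close>, as \<open>R_complete_p\<close>
    requires.\<close>
  define g where "g = (\<lambda>n. f ((p - 1) * n))"
  have "g (Suc n) - g n \<in> E ((p - 1) * n)" for n
    unfolding g_def by (rule E_steps[where f = f, OF step]) auto
  then obtain L where L: "\<And>n. g n - L \<in> E ((p - 1) * n)" using R_complete_p[of g] f unfolding g_def by blast
  have lim: "f n - L \<in> E n" for n
  proof -
    have le: "n \<le> (p - 1) * n" using mult_le_mono1[of 1 "p - 1" n] p_ge_3 by linarith
    have "f n - L = (f n - g n) + (g n - L)" by simp
    also have "\<dots> \<in> E n"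
      using le by (intro E_add E_mono[OF le L]) (auto simp: g_def intro: E_steps[where f = f, OF step])
    finally show ?thesis .
  qed
  moreover have "L \<in> R" using lim[of 0] f[of 0] R.diff_mem[of "f 0" "f 0 - L"] by (simp add: E_0)
  ultimately show ?thesis using that by blast
qed

end

section \<open>The field, its ring of integers and its maximal ideal\<close>

lemma a_inv_ring_of_type_algebra: "\<ominus>\<^bsub>ring_of_type_algebra\<^esub> x = - (x :: 'a::field)"
proof -
  interpret cring "ring_of_type_algebra :: 'a ring" by (rule cring_from_type_algebra)
  show ?thesis by (rule minus_equality) (simp_all add: ring_of_type_algebra_def)
qed

lemma m_inv_ring_of_type_algebra:
  assumes "x \<noteq> (0 :: 'a::field)"
  shows "inv\<^bsub>ring_of_type_algebra\<^esub> x = inverse x"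
proof -
  interpret cring "ring_of_type_algebra :: 'a ring" by (rule cring_from_type_algebra)
  show ?thesis by (rule comm_inv_char) (simp_all add: ring_of_type_algebra_def assms)
qed

context padic_cyclotomic
begin

definition K :: "'a set" where "K = adjoin_root p emb \<zeta>"

lemma K_induct [consumes 1, case_names one zeta Qp uminus inverse add mult]:
  assumes "x \<in> K" and "Q 1" "Q \<zeta>" "\<And>x. x \<in> Qp \<Longrightarrow> Q x" "\<And>x. Q x \<Longrightarrow> Q (- x)"
    "\<And>x. Q x \<Longrightarrow> x \<noteq> 0 \<Longrightarrow> Q (inverse x)"
    "\<And>x y. Q x \<Longrightarrow> Q y \<Longrightarrow> Q (x + y)" "\<And>x y. Q x \<Longrightarrow> Q y \<Longrightarrow> Q (x * y)"
  shows "Q x"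
proof -
  have "x \<in> generate_field ring_of_type_algebra (insert \<zeta> Qp)"
    using assms(1) by (simp add: K_def adjoin_root_def Qp_def)
  thus ?thesis
  proof (induction rule: generate_field.induct)
    case (m_inv h)
    have h: "h \<noteq> 0" using m_inv.hyps by (simp add: ring_of_type_algebra_def)
    show ?case unfolding m_inv_ring_of_type_algebra[OF h] by (rule assms(6)[OF m_inv.IH h])
  next
    case (a_inv h)
    show ?case unfolding a_inv_ring_of_type_algebra by (rule assms(5)[OF a_inv.IH])
  next
    case (incl h)
    thus ?case using assms(3,4) by blast
  qed (simp_all add: ring_of_type_algebra_def assms(2,7,8))
qed

sublocale K: field_subring K
proof -
  have one: "1 \<in> K" using generate_field.one[of ring_of_type_algebra]
    by (simp add: K_def adjoin_root_def ring_of_type_algebra_def)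
  have add: "x + y \<in> K" if "x \<in> K" "y \<in> K" for x y
    using generate_field.eng_add[of x ring_of_type_algebra _ y] that
    by (simp add: K_def adjoin_root_def ring_of_type_algebra_def)
  have mult: "x * y \<in> K" if "x \<in> K" "y \<in> K" for x y
    using generate_field.eng_mult[of x ring_of_type_algebra _ y] that
    by (simp add: K_def adjoin_root_def ring_of_type_algebra_def)
  have uminus: "- x \<in> K" if "x \<in> K" for x
    using generate_field.a_inv[of x ring_of_type_algebra] that
    by (simp add: K_def adjoin_root_def a_inv_ring_of_type_algebra)
  have "0 \<in> K" using add[OF one uminus[OF one]] by simp
  thus "field_subring K" using one add mult uminus by unfold_locales
qed

lemma zeta_K: "\<zeta> \<in> K" and Qp_K: "Qp \<subseteq> K"
  by (auto simp: K_def adjoin_root_def Qp_def intro!: generate_field.incl)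

lemma R_subset_K: "R \<subseteq> K"
proof
  fix x assume "x \<in> R"
  then obtain P where P: "P \<in> Zp.polys" "x = poly P \<pi>" by (auto simp: R_def)
  have "P \<in> K.polys" using P(1) Zp_subset_Qp Qp_K by (auto simp: Zp.polys_def K.polys_def)
  thus "x \<in> K" unfolding P(2) \<pi>_def by (intro K.poly_mem K.diff_mem zeta_K K.one_mem)
qed

section \<open>Orders and denominators of elements of the field, integral closure\<close>

lemma R_valuation:
  assumes r: "r \<in> R" "r \<noteq> 0"
  obtains n u v where "u \<in> R" "v \<in> R" "u * v = 1" "r = \<pi> ^ n * u"
proof -
  have ex: "\<exists>n. r \<notin> E (Suc n)"
  proof (rule ccontr)
    assume "\<not> (\<exists>n. r \<notin> E (Suc n))"
    hence "r \<in> E k" for k using E_mono[of k "Suc k" r] by simp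
    thus False using E_separated r(2) by blast
  qed
  define n where "n = (LEAST n. r \<notin> E (Suc n))"
  have n: "r \<notin> E (Suc n)" unfolding n_def by (rule LeastI_ex[OF ex])
  have "r \<in> E n"
  proof (cases n)
    case 0 thus ?thesis using r(1) by (simp add: E_0)
  next
    case (Suc m)
    hence "m < n" by simp
    from not_less_Least[OF this[unfolded n_def]] Suc show ?thesis by simp
  qed
  then obtain u where u: "u \<in> R" "r = \<pi> ^ n * u" by (auto simp: E_def)
  have "u \<notin> E 1"
  proof
    assume "u \<in> E 1"
    hence "\<pi> ^ n * u \<in> E (n + 1)" by (rule E_mult[OF E_I[OF R.one_mem, of n, simplified]])
    thus False using n u(2) by simp
  qed
  then obtain v where "v \<in> R" "u * v = 1" using R_unit[OF u(1)] by blast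
  thus ?thesis using that u by blast
qed

lemma K_denominator:
  assumes "x \<in> K"
  shows "\<exists>k. of_nat p ^ k * x \<in> R"
  using assms
proof (induction rule: K_induct)
  case one
  show ?case by (rule exI[of _ 0]) simp
next
  case zeta
  have "\<zeta> = \<pi> + 1" by (simp add: \<pi>_def)
  hence "\<zeta> \<in> R" using R.add_mem[OF pi_R R.one_mem] by simp
  thus ?case by (intro exI[of _ 0]) simp
next
  case (Qp x)
  then obtain k where "of_nat p ^ k * x \<in> Zp" by (rule Qp_clear_denominator)
  thus ?case using Zp_R by blast
next
  case (uminus x)
  then obtain k where "of_nat p ^ k * x \<in> R" by blast
  thus ?case using R.uminus_mem by (intro exI[of _ k]) simp
next
  case (inverse x)
  then obtain k where k: "of_nat p ^ k * x \<in> R" by blast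
  have "of_nat p ^ k * x \<noteq> 0" using inverse by simp
  with k obtain n u v where uv: "u \<in> R" "v \<in> R" "u * v = 1" "of_nat p ^ k * x = \<pi> ^ n * u"
    by (rule R_valuation)
  \<comment> \<open>Inverting \<open>x\<close> puts \<open>\<pi> ^ n\<close> into the denominator;
    since \<open>\<pi>\<close> divides \<open>p\<close>, the factor \<open>p ^ n\<close> clears
    it.\<close>
  have "of_nat p \<in> E 1" using p_ge_3 by (intro E_mono[OF _ p_E]) simp
  then obtain q where q: "q \<in> R" "of_nat p = \<pi> * q" by (auto simp: E_def)
  have "x * (q ^ n * of_nat p ^ k * v) = (of_nat p ^ k * x) * (q ^ n * v)" by (simp add: mult_ac)
  also have "\<dots> = (\<pi> * q) ^ n * (u * v)" unfolding uv(4) by (simp add: mult_ac power_mult_distrib)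
  also have "\<dots> = of_nat p ^ n" unfolding uv(3) q(2)[symmetric] by simp
  finally have "of_nat p ^ n * inverse x = q ^ n * of_nat p ^ k * v"
    using inverse(2) by (simp add: field_simps)
  moreover have "q ^ n * of_nat p ^ k * v \<in> R" by (intro R_intros q uv)
  ultimately show ?case by (intro exI[of _ n]) simp
next
  case (add x y)
  then obtain k l where kl: "of_nat p ^ k * x \<in> R" "of_nat p ^ l * y \<in> R" by blast
  have "of_nat p ^ (k + l) * (x + y) = of_nat p ^ l * (of_nat p ^ k * x) + of_nat p ^ k * (of_nat p ^ l * y)"
    by (simp add: power_add algebra_simps)
  also have "\<dots> \<in> R" by (intro R_intros kl)
  finally show ?case ..
next
  case (mult x y)
  then obtain k l where kl: "of_nat p ^ k * x \<in> R" "of_nat p ^ l * y \<in> R" by blast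
  have "of_nat p ^ (k + l) * (x * y) = (of_nat p ^ k * x) * (of_nat p ^ l * y)"
    by (simp add: power_add mult_ac)
  also have "\<dots> \<in> R" by (intro R_intros kl)
  finally show ?case ..
qed

text \<open>Compare the order \<open>n\<close> of \<open>p ^ k * x\<close> with the order
  \<open>(p - 1) * k\<close> of \<open>p ^ k\<close>: if \<open>n\<close> were at least as large,
  \<open>x\<close> would lie in \<open>R\<close>. The difference \<open>m\<close> is the pole order
  of \<open>x\<close>.\<close>

lemma K_not_R:
  assumes x: "x \<in> K" "x \<notin> R"
  obtains m y z where "m > 0" "y \<in> R" "z \<in> R" "y * z = 1" "y = \<pi> ^ m * x"
proof -
  obtain k where k: "of_nat p ^ k * x \<in> R" using K_denominator[OF x(1)] by blast
  have "of_nat p ^ k * x \<noteq> 0" using x(2) by auto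
  with k obtain n u v where uv: "u \<in> R" "v \<in> R" "u * v = 1" "of_nat p ^ k * x = \<pi> ^ n * u"
    by (rule R_valuation)
  have lt: "n < (p - 1) * k"
  proof (rule ccontr)
    assume "\<not> n < (p - 1) * k"
    hence "of_nat p ^ k * x \<in> E ((p - 1) * k)"
      unfolding uv(4) by (intro E_mono[OF _ E_I[OF uv(1)]]) simp
    thus False using p_power_E[of k x 0] x(2) by (simp add: E_0)
  qed
  obtain \<epsilon> \<epsilon>' where e: "\<epsilon> \<in> R" "\<epsilon>' \<in> R" "\<epsilon> * \<epsilon>' = 1" "of_nat p = \<pi> ^ (p - 1) * \<epsilon>"
    by (rule p_eq_pi_power)
  define m where "m = (p - 1) * k - n"
  have "\<pi> ^ ((p - 1) * k) * (\<epsilon> ^ k * (\<pi> ^ m * x)) = \<pi> ^ m * (of_nat p ^ k * x)"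
  proof -
    have "of_nat p ^ k = \<pi> ^ ((p - 1) * k) * \<epsilon> ^ k"
      unfolding e(4) by (simp add: power_mult power_mult_distrib)
    thus ?thesis by (simp only: mult_ac)
  qed
  also have "\<dots> = \<pi> ^ (m + n) * u" unfolding uv(4) by (simp add: power_add mult.assoc)
  also have "m + n = (p - 1) * k" using lt by (simp add: m_def)
  finally have eu: "\<epsilon> ^ k * (\<pi> ^ m * x) = u" by simp
  have "\<pi> ^ m * x = (\<epsilon> * \<epsilon>') ^ k * (\<pi> ^ m * x)" unfolding e(3) by simp
  also have "\<dots> = \<epsilon>' ^ k * u" unfolding eu[symmetric] by (simp add: power_mult_distrib mult_ac)
  finally have y: "\<pi> ^ m * x = \<epsilon>' ^ k * u" .
  show ?thesis
  proof (rule that[of m "\<pi> ^ m * x" "\<epsilon> ^ k * v"])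
    show "m > 0" using lt by (simp add: m_def)
    show "\<pi> ^ m * x \<in> R" unfolding y by (intro R_intros e uv)
    show "\<epsilon> ^ k * v \<in> R" by (intro R_intros e uv)
    show "\<pi> ^ m * x * (\<epsilon> ^ k * v) = 1" using uv(3) eu by (simp add: mult_ac)
  qed simp
qed

text \<open>Otherwise \<open>x\<close> is a unit \<open>y\<close> divided by
  \<open>\<pi> ^ m\<close> with \<open>m > 0\<close>. Clearing denominators in the monic equation
  leaves \<open>y ^ d\<close> on one side and multiples of \<open>\<pi>\<close> on the other, which
  is impossible for a unit.\<close>

lemma integral_imp_R:
  assumes x: "x \<in> K" and P: "Polynomial.lead_coeff P = 1" "P \<in> Zp.polys" "poly P x = 0"
  shows "x \<in> R"
proof (rule ccontr)
  assume "x \<notin> R"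
  with x obtain m y z where y: "m > 0" "y \<in> R" "z \<in> R" "y * z = 1" "y = \<pi> ^ m * x" by (rule K_not_R)
  define d where "d = Polynomial.degree P"
  have "(\<Sum>i<d. Polynomial.coeff P i * x ^ i) + x ^ d = 0"
    using P(1,3) by (simp add: poly_altdef d_def lessThan_Suc_atMost[symmetric])
  hence "x ^ d = - (\<Sum>i<d. Polynomial.coeff P i * x ^ i)"
    by (simp add: eq_neg_iff_add_eq_0 add.commute)
  hence "y ^ d = - (\<Sum>i<d. (\<pi> ^ m) ^ d * (Polynomial.coeff P i * x ^ i))"
    unfolding y(5) by (simp add: power_mult_distrib sum_distrib_left)
  also have "(\<Sum>i<d. (\<pi> ^ m) ^ d * (Polynomial.coeff P i * x ^ i)) =
      (\<Sum>i<d. \<pi> ^ (m * (d - i)) * (Polynomial.coeff P i * y ^ i))"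
  proof (rule sum.cong[OF refl])
    fix i assume "i \<in> {..<d}"
    hence "(\<pi> ^ m) ^ d = \<pi> ^ (m * (d - i)) * (\<pi> ^ m) ^ i"
      by (simp add: power_mult[symmetric] power_add[symmetric] distrib_left[symmetric])
    thus "(\<pi> ^ m) ^ d * (Polynomial.coeff P i * x ^ i) = \<pi> ^ (m * (d - i)) * (Polynomial.coeff P i * y ^ i)"
      unfolding y(5) by (simp add: power_mult_distrib)
  qed
  finally have eq: "y ^ d = - (\<Sum>i<d. \<pi> ^ (m * (d - i)) * (Polynomial.coeff P i * y ^ i))" .
  have "y ^ d \<in> E 1"
    unfolding eq
  proof (intro E_uminus E_sum)
    fix i assume "i \<in> {..<d}"
    hence "1 \<le> m * (d - i)" using y(1) by simp
    moreover have "Polynomial.coeff P i * y ^ i \<in> R"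
      by (intro R_intros Zp_R Zp.coeff_mem P y)
    ultimately show "\<pi> ^ (m * (d - i)) * (Polynomial.coeff P i * y ^ i) \<in> E 1"
      by (intro E_mono[OF _ E_I])
  qed
  hence "y ^ d * z ^ d \<in> E 1" by (intro E_mult_R R_intros y)
  moreover have "y ^ d * z ^ d = 1" using y(4) by (simp add: power_mult_distrib[symmetric])
  ultimately show False using one_not_E by simp
qed

text \<open>Multiplication by \<open>x\<close> acts on the tuple of powers \<open>\<pi> ^ i\<close>
  through a matrix over \<open>Zp\<close> given by \<open>R_span\<close>; the entry
  \<open>\<pi> ^ 0 = 1\<close> shows that the tuple is nonzero.\<close>

lemma R_imp_integral:
  assumes x: "x \<in> R"
  obtains P where "Polynomial.lead_coeff P = 1" "P \<in> Zp.polys" "poly P x = 0"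
proof -
  have "\<exists>a. (\<forall>j. a j \<in> Zp) \<and> x * \<pi> ^ i = (\<Sum>j<p-1. a j * \<pi> ^ j)" for i
  proof -
    have "x * \<pi> ^ i \<in> R" by (intro R_intros x)
    then obtain a where "\<And>j. a j \<in> Zp" "x * \<pi> ^ i = (\<Sum>j<p-1. a j * \<pi> ^ j)" by (rule R_span) blast
    thus ?thesis by blast
  qed
  hence "\<forall>i. \<exists>a. (\<forall>j. a j \<in> Zp) \<and> x * \<pi> ^ i = (\<Sum>j<p-1. a j * \<pi> ^ j)" by blast
  then obtain A where A: "\<forall>i. (\<forall>j. A i j \<in> Zp) \<and> x * \<pi> ^ i = (\<Sum>j<p-1. A i j * \<pi> ^ j)"
    unfolding choice_iff by blast
  show ?thesis
  proof (rule Zp.integral_of_matrix_action[of "p - 1" A x "\<lambda>i. \<pi> ^ i" 0])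
    show "A i j \<in> Zp" for i j using A by blast
    show "x * \<pi> ^ i = (\<Sum>j<p-1. A i j * \<pi> ^ j)" for i using A by blast
    show "0 < p - 1" using p_ge_3 by simp
    show "\<pi> ^ 0 \<noteq> 0" by simp
  qed (rule that)
qed

section \<open>The ring of integers, its maximal ideal and the square of that ideal\<close>

abbreviation \<O> :: "'a ring" where "\<O> \<equiv> integers_of p emb K"

lemma integers_of_eq: "\<O> = ring_of_type_algebra\<lparr>carrier := R\<rparr>"
proof -
  have polys: "P \<in> Zp.polys \<longleftrightarrow> (\<forall>i. Polynomial.coeff P i \<in> emb ` padic_integers p)" for P
    unfolding Zp.polys_def unfolding Zp_def by simp
  have "{x \<in> K. \<exists>P. Polynomial.lead_coeff P = 1 \<and> (\<forall>i. Polynomial.coeff P i \<in> emb ` padic_integers p) \<and>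
      poly P x = 0} = R"
  proof (intro equalityI subsetI)
    fix x assume "x \<in> {x \<in> K. \<exists>P. Polynomial.lead_coeff P = 1 \<and>
      (\<forall>i. Polynomial.coeff P i \<in> emb ` padic_integers p) \<and> poly P x = 0}"
    then obtain P where "x \<in> K" "Polynomial.lead_coeff P = 1" "P \<in> Zp.polys" "poly P x = 0"
      unfolding polys by blast
    thus "x \<in> R" by (rule integral_imp_R)
  next
    fix x assume x: "x \<in> R"
    then obtain P where "Polynomial.lead_coeff P = 1" "P \<in> Zp.polys" "poly P x = 0" by (rule R_imp_integral)
    moreover have "x \<in> K" using x R_subset_K by blast
    ultimately show "x \<in> {x \<in> K. \<exists>P. Polynomial.lead_coeff P = 1 \<and>
      (\<forall>i. Polynomial.coeff P i \<in> emb ` padic_integers p) \<and> poly P x = 0}"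
      unfolding polys by blast
  qed
  thus ?thesis by (simp only: integers_of_def)
qed

lemma integers_simps [simp]:
  "carrier \<O> = R" "x \<otimes>\<^bsub>\<O>\<^esub> y = x * y" "x \<oplus>\<^bsub>\<O>\<^esub> y = x + y" "\<one>\<^bsub>\<O>\<^esub> = 1" "\<zero>\<^bsub>\<O>\<^esub> = 0"
  by (simp_all add: integers_of_eq ring_of_type_algebra_def)

lemma cring_integers: "cring \<O>"
proof (intro cringI abelian_groupI comm_monoidI)
  fix x assume "x \<in> carrier \<O>"
  thus "\<exists>y\<in>carrier \<O>. y \<oplus>\<^bsub>\<O>\<^esub> x = \<zero>\<^bsub>\<O>\<^esub>"
    by (intro bexI[of _ "- x"]) (auto intro: R.uminus_mem)
qed (auto simp: algebra_simps intro: R.add_mem R.mult_mem)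

lemma E_ideal: "ideal (E k) \<O>"
proof -
  interpret O: cring \<O> by (rule cring_integers)
  have neg: "\<ominus>\<^bsub>\<O>\<^esub> x = - x" if "x \<in> R" for x
    by (rule O.minus_equality) (use that in \<open>auto intro: R.uminus_mem\<close>)
  show ?thesis
  proof (rule idealI)
    show "ring \<O>" by (rule O.ring_axioms)
    show "subgroup (E k) (add_monoid \<O>)"
    proof (rule O.add.subgroupI)
      show "E k \<subseteq> carrier \<O>" using E_R by auto
      show "E k \<noteq> {}" using E_zero by blast
      show "\<ominus>\<^bsub>\<O>\<^esub> x \<in> E k" if "x \<in> E k" for x
        using neg[OF E_R[OF that]] E_uminus[OF that] by simp
      show "x \<oplus>\<^bsub>\<O>\<^esub> y \<in> E k" if "x \<in> E k" "y \<in> E k" for x y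
        using E_add[OF that] by simp
    qed
    show "y \<otimes>\<^bsub>\<O>\<^esub> x \<in> E k" "x \<otimes>\<^bsub>\<O>\<^esub> y \<in> E k" if "x \<in> E k" "y \<in> carrier \<O>" for x y
      using that by (auto intro: E_mult_R E_mult_R')
  qed
qed

lemma ideal_with_unit:
  assumes "ideal J \<O>" "x \<in> J" "x \<in> R" "x \<notin> E 1"
  shows "J = carrier \<O>"
proof -
  interpret ideal J \<O> by (rule assms(1))
  obtain s where "s \<in> R" "x * s = 1" using R_unit[OF assms(3,4)] by blast
  hence "\<one>\<^bsub>\<O>\<^esub> \<in> J" using I_r_closed[OF assms(2), of s] by simp
  thus ?thesis by (rule one_imp_carrier)
qed

lemma maximalideal_E_1: "maximalideal (E 1) \<O>"
proof (rule maximalidealI[OF E_ideal])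
  show "carrier \<O> \<noteq> E 1" using one_not_E R.one_mem by auto
  fix J assume J: "ideal J \<O>" "E 1 \<subseteq> J" "J \<subseteq> carrier \<O>"
  show "J = E 1 \<or> J = carrier \<O>"
  proof (rule disjCI)
    assume "J \<noteq> carrier \<O>"
    hence "x \<in> E 1" if "x \<in> J" for x
      using ideal_with_unit[OF J(1) that] J(3) that by auto
    thus "J = E 1" using J(2) by blast
  qed
qed

text \<open>The definite description needs uniqueness: a proper ideal contains no unit, hence lies
  in \<open>E 1\<close>, and maximality forces equality.\<close>

lemma max_ideal_eq: "max_ideal_of p emb K = E 1"
  unfolding max_ideal_of_def
proof (rule the_equality[where P = "\<lambda>M. maximalideal M \<O>", OF maximalideal_E_1])
  fix M assume "maximalideal M \<O>"
  then interpret M: maximalideal M \<O> .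
  have M: "ideal M \<O>" by (rule M.ideal_axioms)
  have "M \<subseteq> E 1"
  proof
    fix x assume x: "x \<in> M"
    hence "x \<in> R" using M.Icarr by auto
    thus "x \<in> E 1" using ideal_with_unit[OF M x] M.I_notcarr by metis
  qed
  moreover have "E 1 \<subseteq> carrier \<O>" using E_R by auto
  ultimately have "E 1 = M \<or> E 1 = carrier \<O>" by (intro M.I_maximal E_ideal)
  moreover have "E 1 \<noteq> carrier \<O>" using one_not_E R.one_mem by auto
  ultimately show "M = E 1" by blast
qed

lemma ideal_prod_E: "E 1 \<cdot>\<^bsub>\<O>\<^esub> E 1 = E 2"
proof (intro equalityI subsetI)
  fix x assume "x \<in> E 1 \<cdot>\<^bsub>\<O>\<^esub> E 1"
  thus "x \<in> E 2"
  proof (induction rule: ideal_prod.induct)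
    case (prod i j)
    thus ?case using E_mult[of i 1 j 1] by (simp add: numeral_2_eq_2)
  next
    case (sum s t)
    thus ?case by (simp add: E_add)
  qed
next
  fix x assume "x \<in> E 2"
  then obtain r where r: "r \<in> R" "x = \<pi> ^ 2 * r" by (auto simp: E_def)
  have "\<pi> * r \<in> E 1" by (intro E_mult_R pi_E r)
  from ideal_prod.prod[OF pi_E this, of \<O>] show "x \<in> E 1 \<cdot>\<^bsub>\<O>\<^esub> E 1"
    by (simp add: r(2) power2_eq_square mult.assoc)
qed

section \<open>The logarithm series\<close>

subsection \<open>Denominators\<close>

text \<open>Bernoulli's inequality. For \<open>x\<close> in \<open>E 1\<close> the order of
  \<open>x ^ n / n\<close> is at least \<open>n - (p - 1) * multiplicity p n\<close>; this bound and
  \<open>p ^ multiplicity p n \<le> n\<close> control that number.\<close>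

lemma p_power_ge: "(p - 1) * a + 1 \<le> p ^ a"
proof (induction a)
  case (Suc a)
  have "(p - 1) * 1 \<le> (p - 1) * p ^ a" using p_ge_3 by (intro mult_left_mono) auto
  moreover have "(p - 1) * Suc a = (p - 1) * a + (p - 1) * 1" by simp
  ultimately have "(p - 1) * Suc a + 1 \<le> p ^ a + (p - 1) * p ^ a" using Suc by linarith
  also have "\<dots> = p ^ Suc a" using p_ge_3 by (simp add: mult_eq_if)
  finally show ?case .
qed simp

lemma p_power_multiplicity_le: "n > 0 \<Longrightarrow> p ^ multiplicity p n \<le> n"
  by (intro dvd_imp_le multiplicity_dvd)

lemma multiplicity_le_1: "n > 0 \<Longrightarrow> (p - 1) * multiplicity p n + 1 \<le> n"
  using p_power_ge[of "multiplicity p n"] p_power_multiplicity_le[of n] by linarith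

text \<open>Equality in \<open>p_power_ge\<close> occurs only at exponents 0 and 1, that is for
  \<open>n = 1\<close> and \<open>n = p\<close>. If \<open>n\<close> is not a power of
  \<open>p\<close>, then \<open>n\<close> exceeds \<open>p ^ multiplicity p n\<close>, which
  supplies the extra unit.\<close>

lemma multiplicity_le_2:
  assumes "n > 0" "n \<noteq> 1" "n \<noteq> p"
  shows "(p - 1) * multiplicity p n + 2 \<le> n"
proof (cases "n = p ^ multiplicity p n")
  case False
  thus ?thesis using p_power_ge[of "multiplicity p n"] p_power_multiplicity_le[OF assms(1)] by linarith
next
  case True
  define a where "a = multiplicity p n"
  have n: "n = p ^ a" using True by (simp add: a_def)
  have "a \<noteq> 0" "a \<noteq> 1" using assms n by auto
  then obtain b where b: "a = Suc (Suc b)" by (metis One_nat_def not0_implies_Suc)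
  have "3 \<le> p ^ Suc b" using p_ge_3 order.trans[of 3 p "p ^ Suc b"] by simp
  hence "(p - 1) * 3 \<le> (p - 1) * p ^ Suc b" by (intro mult_left_mono) auto
  moreover have "p ^ a = p ^ Suc b + (p - 1) * p ^ Suc b" using p_ge_3 by (simp add: b mult_eq_if)
  moreover have "(p - 1) * a = (p - 1) * Suc b + (p - 1)" by (simp add: b)
  moreover have "p - 1 \<ge> 2" using p_ge_3 by simp
  ultimately have "(p - 1) * a + 2 \<le> p ^ a" using p_power_ge[of "Suc b"] by linarith
  thus ?thesis by (simp only: n[symmetric] a_def[symmetric])
qed

text \<open>An explicit rate of convergence: from index \<open>p * k\<close> on, the terms lie in
  \<open>E k\<close>. With \<open>v\<close> the multiplicity, \<open>n \<ge> p * k\<close> settles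
  \<open>v \<le> k\<close>, and \<open>n \<ge> p ^ v \<ge> p * v\<close> settles
  \<open>v > k\<close>.\<close>

lemma multiplicity_le_large:
  assumes "n > 0" "n \<ge> p * k"
  shows "(p - 1) * multiplicity p n + k \<le> n"
proof (cases "multiplicity p n \<le> k")
  case True
  hence "(p - 1) * multiplicity p n + k \<le> (p - 1) * k + k" by simp
  also have "\<dots> = p * k" using p_ge_3 by (simp add: mult_eq_if)
  finally show ?thesis using assms(2) by simp
next
  case False
  then obtain a where a: "multiplicity p n = Suc a" by (cases "multiplicity p n") auto
  have "Suc a \<le> p ^ a"
    using p_power_ge[of a] p_ge_3 mult_le_mono1[of 1 "p - 1" a] by linarith
  hence "p * Suc a \<le> p * p ^ a" by (rule mult_le_mono2)
  also have "\<dots> = p ^ Suc a" by simp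
  also have "\<dots> \<le> n" using p_power_multiplicity_le[OF assms(1)] by (simp only: a)
  finally have "(p - 1) * Suc a + Suc a \<le> n" using p_ge_3 by (simp add: mult_eq_if)
  thus ?thesis using False unfolding a by linarith
qed

lemma of_nat_decompose:
  assumes "n > 0"
  obtains m s where "s \<in> R" "(of_nat m :: 'a) * s = 1" "n = p ^ multiplicity p n * m"
proof -
  have "\<not> is_unit p" using prime_p by auto
  then obtain m where m: "n = p ^ multiplicity p n * m" "\<not> p dvd m"
    using assms multiplicity_decompose'[of n p] by blast
  have "of_nat m \<notin> E 1" using m(2) of_nat_E_1_iff by blast
  with R_unit[OF R.of_nat_mem this] that m(1) show ?thesis by blast
qed

lemma of_nat_nonzero: "n > 0 \<Longrightarrow> (of_nat n :: 'a) \<noteq> 0"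
proof -
  assume "n > 0"
  then obtain m s where ms: "(of_nat m :: 'a) * s = 1" "n = p ^ multiplicity p n * m"
    by (rule of_nat_decompose)
  have "(of_nat n :: 'a) = of_nat p ^ multiplicity p n * of_nat m"
    using arg_cong[OF ms(2), of "of_nat :: nat \<Rightarrow> 'a"] by simp
  moreover have "(of_nat m :: 'a) \<noteq> 0" using ms(1) by auto
  ultimately show ?thesis by simp
qed

lemma E_divide_of_nat:
  assumes n: "n > 0" and y: "y \<in> E (c + (p - 1) * multiplicity p n)"
  shows "y / of_nat n \<in> E c"
proof -
  obtain m s where ms: "s \<in> R" "(of_nat m :: 'a) * s = 1" "n = p ^ multiplicity p n * m"
    using n by (rule of_nat_decompose)
  have eq: "(of_nat n :: 'a) = of_nat p ^ multiplicity p n * of_nat m"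
    using arg_cong[OF ms(3), of "of_nat :: nat \<Rightarrow> 'a"] by simp
  have "(of_nat m :: 'a) \<noteq> 0" using ms(2) by auto
  hence "of_nat p ^ multiplicity p n * (y / of_nat n) = y * (of_nat m * s) / of_nat m"
    unfolding eq ms(2) by simp
  also have "\<dots> = y * s" using \<open>(of_nat m :: 'a) \<noteq> 0\<close> by simp
  also have "\<dots> \<in> E ((p - 1) * multiplicity p n + c)"
    using E_mult_R[OF y ms(1)] by (simp add: add.commute)
  finally show ?thesis unfolding p_power_E .
qed

subsection \<open>Partial sums and convergence\<close>

definition log_term :: "'a \<Rightarrow> nat \<Rightarrow> 'a" where
  "log_term x n = (-1) ^ (n - 1) * x ^ n / of_nat n"

definition log_sum :: "nat \<Rightarrow> 'a \<Rightarrow> 'a" where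
  "log_sum N x = (\<Sum>n=1..N. log_term x n)"

lemma log_term_E:
  assumes "x \<in> E 1" "n > 0" "(p - 1) * multiplicity p n + c \<le> n"
  shows "log_term x n \<in> E c"
proof -
  have "x ^ n \<in> E n" using E_power[OF assms(1), of n] by simp
  hence "(-1) ^ (n - 1) * x ^ n \<in> E n" by (intro E_mult_R' R_intros)
  hence "(-1) ^ (n - 1) * x ^ n \<in> E (c + (p - 1) * multiplicity p n)"
    using assms(3) by (intro E_mono[of "c + (p - 1) * multiplicity p n" n]) simp_all
  thus ?thesis unfolding log_term_def by (rule E_divide_of_nat[OF assms(2)])
qed

lemma log_sum_Suc: "log_sum (Suc N) x = log_sum N x + log_term x (Suc N)"
  by (simp add: log_sum_def)

lemma log_sum_diff_E:
  assumes x: "x \<in> E 1" and "p * k \<le> M" "M \<le> N"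
  shows "log_sum N x - log_sum M x \<in> E k"
  using assms(3)
proof (induction N rule: dec_induct)
  case (step N)
  have "log_term x (Suc N) \<in> E k"
    using step.hyps assms(2) by (intro log_term_E x multiplicity_le_large) auto
  from E_add[OF step.IH this] show ?case by (simp add: log_sum_Suc algebra_simps)
qed simp

lemma log_sum_R:
  assumes "x \<in> E 1"
  shows "log_sum N x \<in> R"
  unfolding log_sum_def
proof (rule R.sum_mem)
  fix n assume "n \<in> {1..N}"
  thus "log_term x n \<in> R" using assms multiplicity_le_1[of n] by (intro E_R[of _ 1] log_term_E) auto
qed

lemma padic_tendsto_iff:
  "padic_tendsto p emb K f l \<longleftrightarrow> (\<forall>k. \<exists>N. \<forall>n\<ge>N. f n - l \<in> E ((p - 1) * k))"
  unfolding padic_tendsto_def E_p_power by simp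

lemma padic_tendsto_unique:
  assumes "padic_tendsto p emb K f l" "padic_tendsto p emb K f l'"
  shows "l = l'"
proof -
  have "l - l' \<in> E k" for k
  proof -
    obtain M N where "\<forall>n\<ge>M. f n - l \<in> E ((p - 1) * k)" "\<forall>n\<ge>N. f n - l' \<in> E ((p - 1) * k)"
      using assms unfolding padic_tendsto_iff by blast
    hence "f (max M N) - l' \<in> E ((p - 1) * k)" "f (max M N) - l \<in> E ((p - 1) * k)" by simp_all
    from E_diff[OF this] have "l - l' \<in> E ((p - 1) * k)" by simp
    moreover have "k \<le> (p - 1) * k" using mult_le_mono1[of 1 "p - 1" k] p_ge_3 by linarith
    ultimately show ?thesis by (rule E_mono[rotated])
  qed
  hence "l - l' = 0" by (rule E_separated)
  thus ?thesis by simp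
qed

definition log1p :: "'a \<Rightarrow> 'a" where "log1p x = padic_log p emb K (1 + x)"

text \<open>The limit in \<open>padic_log\<close> exists by completeness and is unique by
  separatedness. Later facts about the logarithm rest on this estimate for partial sums.\<close>

lemma log1p_approx:
  assumes x: "x \<in> E 1" and N: "p * k \<le> N"
  shows "log_sum N x - log1p x \<in> E k"
proof -
  \<comment> \<open>Along \<open>N = p * k\<close> consecutive partial sums differ by an element of
    \<open>E k\<close>, the rate that \<open>R_complete\<close> asks for.\<close>
  have "log_sum (p * Suc k) x - log_sum (p * k) x \<in> E k" for k
    by (rule log_sum_diff_E[OF x]) auto
  from R_complete[of "\<lambda>k. log_sum (p * k) x", OF log_sum_R[OF x] this]
  obtain l where l: "l \<in> R" "\<And>k. log_sum (p * k) x - l \<in> E k" by blast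
  have approx: "log_sum N x - l \<in> E k" if "p * k \<le> N" for N k
    using E_add[OF log_sum_diff_E[OF x order_refl that] l(2)[of k]] by simp
  have tendsto: "padic_tendsto p emb K (\<lambda>N. log_sum N x) l"
    unfolding padic_tendsto_iff using approx by blast
  have "log1p x = l"
    unfolding log1p_def padic_log_def
  proof (rule the_equality)
    show "l \<in> K \<and> padic_tendsto p emb K (\<lambda>N. \<Sum>n = 1..N. (- 1) ^ (n - 1) * (1 + x - 1) ^ n / of_nat n) l"
      using tendsto l(1) R_subset_K by (auto simp: log_sum_def log_term_def)
    fix l' assume "l' \<in> K \<and> padic_tendsto p emb K (\<lambda>N. \<Sum>n = 1..N. (- 1) ^ (n - 1) * (1 + x - 1) ^ n / of_nat n) l'"
    hence "padic_tendsto p emb K (\<lambda>N. log_sum N x) l'" by (simp add: log_sum_def log_term_def)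
    thus "l' = l" using tendsto by (rule padic_tendsto_unique)
  qed
  thus ?thesis using approx[OF N] by simp
qed

subsection \<open>The logarithm is close to the identity on small increments\<close>

text \<open>Expanding \<open>(x + h) ^ n\<close> and using \<open>C(n, j) / n = C(n - 1, j - 1) / j\<close>, the denominator of the
  term with \<open>h ^ j\<close> is \<open>j\<close> instead of \<open>n\<close>.\<close>

lemma power_increment_E:
  assumes x: "x \<in> E 1" and h: "h \<in> E k" and k: "k \<ge> 2" and n: "n \<ge> 2"
  shows "((x + h) ^ n - x ^ n) / of_nat n \<in> E (Suc k)"
proof -
  obtain m where m: "n = Suc m" "m \<ge> 1" using n by (cases n) auto
  have "(x + h) ^ n = (\<Sum>j\<le>Suc m. of_nat (Suc m choose j) * h ^ j * x ^ (Suc m - j))"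
    using binomial_ring[of h x "Suc m"] by (simp only: m add.commute)
  also have "\<dots> = x ^ n + (\<Sum>i\<le>m. of_nat (Suc m choose Suc i) * h ^ Suc i * x ^ (m - i))"
    by (simp only: sum.atMost_Suc_shift) (simp add: m)
  finally have "((x + h) ^ n - x ^ n) / of_nat n =
      (\<Sum>i\<le>m. of_nat (Suc m choose Suc i) * h ^ Suc i * x ^ (m - i) / of_nat (Suc m))"
    by (simp add: m sum_divide_distrib)
  also have "\<dots> = (\<Sum>i\<le>m. of_nat (m choose i) * (h ^ Suc i / of_nat (Suc i)) * x ^ (m - i))"
  proof (rule sum.cong[OF refl])
    fix i
    have nz: "(of_nat (Suc m) :: 'a) \<noteq> 0" "(of_nat (Suc i) :: 'a) \<noteq> 0" by (rule of_nat_nonzero, simp)+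
    have "(of_nat (Suc i) :: 'a) * of_nat (Suc m choose Suc i) = of_nat (Suc m) * of_nat (m choose i)"
      by (simp only: of_nat_mult[symmetric] Suc_times_binomial)
    hence "(of_nat (Suc m choose Suc i) :: 'a) / of_nat (Suc m) = of_nat (m choose i) / of_nat (Suc i)"
      using nz by (simp add: frac_eq_eq mult.commute del: of_nat_Suc)
    hence "(of_nat (Suc m choose Suc i) / of_nat (Suc m)) * (h ^ Suc i * x ^ (m - i)) =
        (of_nat (m choose i) / of_nat (Suc i)) * (h ^ Suc i * x ^ (m - i))" by (rule arg_cong)
    thus "of_nat (Suc m choose Suc i) * h ^ Suc i * x ^ (m - i) / of_nat (Suc m) =
        of_nat (m choose i) * (h ^ Suc i / of_nat (Suc i)) * x ^ (m - i)"
      by (simp add: mult_ac del: of_nat_Suc binomial_Suc_Suc)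
  qed
  also have "\<dots> \<in> E (Suc k)"
  proof (rule E_sum)
    fix i
    show "of_nat (m choose i) * (h ^ Suc i / of_nat (Suc i)) * x ^ (m - i) \<in> E (Suc k)"
    proof (cases "i = 0")
      case True
      \<comment> \<open>In the term linear in \<open>h\<close> the gain of one order comes from
        \<open>x\<close>; \<open>n \<ge> 2\<close> provides at least one such factor.\<close>
      have "x ^ m \<in> E 1" using E_power[OF x, of m] m(2) E_mono[of 1 m] by simp
      from E_mult[OF h this] show ?thesis using True by simp
    next
      case False
      have "1 + (p - 1) * multiplicity p (Suc i) \<le> Suc i" using multiplicity_le_1[of "Suc i"] by simp
      \<comment> \<open>Here \<open>k \<ge> 2\<close> enters:
        \<open>k * i \<ge> 2 * i \<ge> i + 1\<close>, while the denominator costs at most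
        \<open>i\<close>.\<close>
      moreover have "2 * i \<le> k * i" using k by simp
      moreover have "k * Suc i = k + k * i" by simp
      ultimately have "Suc k + (p - 1) * multiplicity p (Suc i) \<le> k * Suc i"
        using False by linarith
      hence "h ^ Suc i \<in> E (Suc k + (p - 1) * multiplicity p (Suc i))"
        using E_power[OF h, of "Suc i"] by (rule E_mono)
      hence "h ^ Suc i / of_nat (Suc i) \<in> E (Suc k)" by (intro E_divide_of_nat) simp_all
      thus ?thesis by (intro E_mult_R[OF E_mult_R'] R_intros E_R[OF x])
    qed
  qed
  finally show ?thesis .
qed

text \<open>The term of index 1 changes by exactly \<open>h\<close>, every later one only by an
  element of \<open>E (Suc k)\<close>.\<close>

lemma log_sum_increment:
  assumes x: "x \<in> E 1" and h: "h \<in> E k" and k: "k \<ge> 2" and "N \<ge> 1"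
  shows "log_sum N (x + h) - log_sum N x - h \<in> E (Suc k)"
  using \<open>N \<ge> 1\<close>
proof (induction N rule: dec_induct)
  case base
  show ?case by (simp add: log_sum_def log_term_def)
next
  case (step N)
  have "log_term (x + h) (Suc N) - log_term x (Suc N) =
      (-1) ^ N * (((x + h) ^ Suc N - x ^ Suc N) / of_nat (Suc N))"
    by (simp only: log_term_def right_diff_distrib diff_divide_distrib times_divide_eq_right diff_Suc_1)
  also have "\<dots> \<in> E (Suc k)"
    using step.hyps by (intro E_mult_R' power_increment_E[OF x h k] R_intros) simp
  finally have "(log_sum N (x + h) - log_sum N x - h) + (log_term (x + h) (Suc N) - log_term x (Suc N)) \<in> E (Suc k)"
    by (rule E_add[OF step.IH])
  thus ?case by (simp add: log_sum_Suc algebra_simps)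
qed

lemma log1p_increment:
  assumes x: "x \<in> E 1" and h: "h \<in> E k" and k: "k \<ge> 2"
  shows "log1p (x + h) - log1p x - h \<in> E (Suc k)"
proof -
  define N where "N = p * Suc k"
  have "h \<in> E 1" using k h by (intro E_mono[OF _ h]) simp
  hence xh: "x + h \<in> E 1" by (rule E_add[OF x])
  have "N \<ge> 1" using p_ge_3 by (simp add: N_def)
  have "log1p (x + h) - log1p x - h =
      (log_sum N (x + h) - log_sum N x - h) - (log_sum N (x + h) - log1p (x + h)) + (log_sum N x - log1p x)"
    by simp
  also have "\<dots> \<in> E (Suc k)"
    by (intro E_add[OF E_diff] log_sum_increment[OF x h k \<open>N \<ge> 1\<close>] log1p_approx x xh) (simp_all add: N_def)
  finally show ?thesis .
qed

subsection \<open>The image\<close>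

text \<open>Modulo \<open>\<pi>\<close> every element of \<open>R\<close> is a natural number, so
  Fermat's theorem for integers applies.\<close>

lemma fermat_E:
  assumes r: "r \<in> R"
  shows "r - r ^ p \<in> E 1"
proof -
  obtain a r' where ar: "r' \<in> R" "r = of_nat a + \<pi> * r'" using r by (rule R_residue)
  have diff: "r - of_nat a \<in> E 1" unfolding ar(2) using E_mult_R[OF pi_E ar(1)] by simp
  have pow: "r ^ n - of_nat a ^ n \<in> E 1" for n
  proof (induction n)
    case (Suc n)
    have "r ^ Suc n - of_nat a ^ Suc n = (r - of_nat a) * r ^ n + of_nat a * (r ^ n - of_nat a ^ n)"
      by (simp add: algebra_simps)
    also have "\<dots> \<in> E 1"
      by (intro E_add E_mult_R[OF diff] E_mult_R'[OF _ Suc.IH] R_intros r)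
    finally show ?case .
  qed simp
  have "of_nat a ^ p - of_nat a \<in> E 1"
  proof (cases "p dvd a")
    case True
    hence "of_nat a \<in> E 1" by (simp only: of_nat_E_1_iff)
    moreover have "of_nat a ^ p \<in> E 1"
      using E_power[OF calculation, of p] E_mono[of 1 p] p_ge_3 by simp
    ultimately show ?thesis by (intro E_diff)
  next
    case False
    have "a > 0" using False by (cases a) auto
    hence "1 \<le> a ^ (p - 1)" by simp
    have "[a ^ (p - 1) = 1] (mod p)" by (rule fermat_theorem[OF prime_p False])
    hence "p dvd a ^ (p - 1) - 1"
      by (rule cong_to_1_nat)
    hence "of_nat (a ^ (p - 1) - 1) \<in> E 1" by (simp only: of_nat_E_1_iff)
    hence "of_nat (a * (a ^ (p - 1) - 1)) \<in> E 1"
      unfolding of_nat_mult by (intro E_mult_R' R.of_nat_mem)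
    moreover have "a * (a ^ (p - 1) - 1) = a ^ p - a"
      using power_eq_if[of a p] p_ge_3 by (simp add: diff_mult_distrib2)
    moreover have "a \<le> a ^ p" using \<open>a > 0\<close> p_ge_3 by (intro self_le_power) auto
    hence "(of_nat (a ^ p - a) :: 'a) = of_nat a ^ p - of_nat a" by (simp add: of_nat_diff)
    ultimately show ?thesis by (simp only:)
  qed
  from E_diff[OF E_diff[OF diff pow[of p]] this] show ?thesis by (simp add: algebra_simps)
qed

text \<open>All terms but those of index \<open>1\<close> and \<open>p\<close> lie in \<open>E 2\<close>; the sum of these two vanishes modulo \<open>E 2\<close>
  because \<open>\<pi> ^ p / p\<close> is congruent to \<open>- \<pi>\<close>.\<close>

lemma log_terms_1_p_E:
  assumes x: "x \<in> E 1"
  shows "log_term x 1 + log_term x p \<in> E 2"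
proof -
  obtain r where r: "r \<in> R" "x = \<pi> * r" using x by (auto simp: E_def)
  obtain g where g: "g \<in> R" "\<pi> ^ (p - 1) = - of_nat p * (1 + \<pi> * g)" by (rule pi_power_eisenstein)
  \<comment> \<open>Oddness gives the term of index \<open>p\<close> a positive sign, so that
    \<open>\<pi> ^ p / p\<close>, congruent to \<open>- \<pi>\<close>, is opposed to the linear term
    and \<open>r - r ^ p\<close> remains.\<close>
  have "odd p" using prime_p p_ge_3 prime_odd_nat[of p] by simp
  hence sign: "(-1 :: 'a) ^ (p - 1) = 1" by simp
  have "\<pi> ^ p = \<pi> * \<pi> ^ (p - 1)" using p_ge_3 by (simp add: power_eq_if)
  also have "\<dots> = of_nat p * (\<pi> * (- (1 + \<pi> * g)))" unfolding g(2) by (simp add: algebra_simps)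
  finally have "\<pi> ^ p = of_nat p * (\<pi> * (- (1 + \<pi> * g)))" .
  hence "log_term x p = \<pi> * (- (1 + \<pi> * g)) * r ^ p"
    unfolding log_term_def r(2) power_mult_distrib sign by (simp only:) simp
  hence "log_term x 1 + log_term x p = \<pi> * ((r - r ^ p) - \<pi> * (g * r ^ p))"
    by (simp add: log_term_def r(2) algebra_simps)
  also have "\<dots> \<in> E (1 + 1)"
    by (intro E_mult pi_E E_diff fermat_E r E_mult_R[OF pi_E] R_intros g)
  finally show ?thesis by (simp add: numeral_2_eq_2)
qed

lemma log1p_E_2:
  assumes x: "x \<in> E 1"
  shows "log1p x \<in> E 2"
proof -
  define N where "N = p * 2"
  have "{1..N} = insert 1 (insert p ({1..N} - {1, p}))" using p_ge_3 by (auto simp: N_def)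
  hence "log_sum N x = (\<Sum>n\<in>insert 1 (insert p ({1..N} - {1, p})). log_term x n)"
    unfolding log_sum_def by (rule arg_cong)
  also have "\<dots> = (log_term x 1 + log_term x p) + (\<Sum>n\<in>{1..N} - {1, p}. log_term x n)"
    using p_ge_3 by (simp add: add.assoc)
  also have "\<dots> \<in> E 2"
  proof (intro E_add[OF log_terms_1_p_E[OF x]] E_sum log_term_E[OF x])
    fix n assume "n \<in> {1..N} - {1, p}"
    thus "n > 0" "(p - 1) * multiplicity p n + 2 \<le> n" using multiplicity_le_2[of n] by auto
  qed
  finally have "log_sum N x \<in> E 2" .
  from E_diff[OF this log1p_approx[OF x, of 2 N]] show ?thesis by (simp add: N_def)
qed

text \<open>Successive approximation: replacing \<open>x\<close> by \<open>x - (log1p x - y)\<close> improves the error by one power of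
  \<open>\<pi>\<close> and does not change \<open>x\<close> modulo \<open>E 2\<close>.\<close>

lemma log1p_surj:
  assumes y: "y \<in> E 2"
  obtains x where "x \<in> E 1" "x - \<pi> \<in> E 2" "log1p x = y"
proof -
  define u where "u = rec_nat \<pi> (\<lambda>_ x. x - (log1p x - y))"
  have u0: "u 0 = \<pi>" and uSuc: "u (Suc n) = u n - (log1p (u n) - y)" for n
    by (simp_all add: u_def)
  \<comment> \<open>The error starts in \<open>E 2\<close> because both \<open>log1p \<pi>\<close>
    and \<open>y\<close> lie there; hence every correction is in the range of
    \<open>log1p_increment\<close>.\<close>
  have inv: "u n \<in> E 1 \<and> u n - \<pi> \<in> E 2 \<and> log1p (u n) - y \<in> E (n + 2)" for n
  proof (induction n)
    case 0
    show ?case using u0 pi_E E_diff[OF log1p_E_2[OF pi_E] y] by (simp add: numeral_2_eq_2)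
  next
    case (Suc n)
    define h where "h = - (log1p (u n) - y)"
    have h: "h \<in> E (n + 2)" unfolding h_def using Suc.IH by (intro E_uminus) blast
    have u_h: "u (Suc n) = u n + h" by (simp add: uSuc h_def)
    have "h \<in> E 2" "h \<in> E 1" by (rule E_mono[OF _ h], simp)+
    hence "u n + h \<in> E 1" "(u n - \<pi>) + h \<in> E 2" using Suc.IH E_add by blast+
    moreover have "log1p (u n + h) - log1p (u n) - h \<in> E (Suc (n + 2))"
      using Suc.IH h by (intro log1p_increment) auto
    ultimately show ?case unfolding u_h by (simp add: h_def algebra_simps)
  qed
  have uR: "u n \<in> R" for n using inv[of n] E_R by blast
  have step: "u (Suc n) - u n \<in> E n" for n
  proof -
    have "- (log1p (u n) - y) \<in> E (n + 2)" using inv[of n] by (intro E_uminus) blast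
    thus ?thesis unfolding uSuc using E_mono[of n "n + 2"] by simp
  qed
  from R_complete[of u, OF uR step] obtain x where x: "x \<in> R" "\<And>n. u n - x \<in> E n" by blast
  have "u 2 - \<pi> \<in> E 2" using inv by blast
  from E_diff[OF this x(2)[of 2]] have xpi: "x - \<pi> \<in> E 2" by (simp add: algebra_simps)
  have x1: "x \<in> E 1" using E_add[OF E_mono[OF _ xpi, of 1] pi_E] by simp
  have "log1p x - y \<in> E k" for k
  proof -
    \<comment> \<open>The shift by 2 keeps the increment \<open>x - u n\<close> in the range of
      \<open>log1p_increment\<close>.\<close>
    define n where "n = k + 2"
    have h: "x - u n \<in> E n" using E_uminus[OF x(2)[of n]] by simp
    have "log1p (u n + (x - u n)) - log1p (u n) - (x - u n) \<in> E (Suc n)"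
      using inv[of n] by (intro log1p_increment h) (auto simp: n_def)
    hence "log1p x - log1p (u n) - (x - u n) \<in> E n" using E_mono[of n "Suc n"] by simp
    moreover have "log1p (u n) - y \<in> E n" using inv[of n] E_mono[of n "n + 2"] by simp
    ultimately have "(log1p x - log1p (u n) - (x - u n)) + (x - u n) + (log1p (u n) - y) \<in> E n"
      using h by (intro E_add)
    hence "log1p x - y \<in> E n" by simp
    thus ?thesis using E_mono[of k n] by (simp add: n_def)
  qed
  hence "log1p x - y = 0" by (rule E_separated)
  thus ?thesis using that x1 xpi by simp
qed

lemma pi_not_E_2: "\<pi> \<notin> E 2"
proof
  assume "\<pi> \<in> E 2"
  hence "\<pi> ^ 1 * 1 \<in> E (1 + 1)" by (simp add: numeral_2_eq_2)
  hence "1 \<in> E 1" by (rule E_cancel_power)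
  thus False using one_not_E by blast
qed

text \<open>One inclusion holds on all of \<open>1 + E 1\<close>. For the other, the preimage from
  \<open>log1p_surj\<close> is congruent to \<open>\<pi>\<close> modulo \<open>E 2\<close> and so
  avoids \<open>E 2\<close>.\<close>

lemma padic_log_image: "padic_log p emb K ` ((+) 1 ` E 1 - (+) 1 ` E 2) = E 2"
proof (intro equalityI subsetI)
  fix y assume "y \<in> padic_log p emb K ` ((+) 1 ` E 1 - (+) 1 ` E 2)"
  then obtain x where "x \<in> E 1" "y = log1p x" unfolding log1p_def by blast
  thus "y \<in> E 2" using log1p_E_2 by simp
next
  fix y assume "y \<in> E 2"
  then obtain x where x: "x \<in> E 1" "x - \<pi> \<in> E 2" "log1p x = y" by (rule log1p_surj)
  have "x \<notin> E 2"
  proof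
    assume "x \<in> E 2"
    from E_diff[OF this x(2)] pi_not_E_2 show False by simp
  qed
  hence "1 + x \<in> (+) 1 ` E 1 - (+) 1 ` E 2" using x(1) by auto
  thus "y \<in> padic_log p emb K ` ((+) 1 ` E 1 - (+) 1 ` E 2)"
    using x(3) unfolding log1p_def by blast
qed

end

theorem theorem2p1:
  fixes p :: nat
    and emb :: "(nat \<Rightarrow> rat) set \<Rightarrow> 'a::field"
    and \<zeta> :: 'a
    and K \<mm> :: "'a set"
  assumes "Factorial_Ring.prime p" and "p \<ge> 3"
    and "emb \<in> ring_hom (padic_field p) ring_of_type_algebra"
    and "primitive_root_of_unity p \<zeta>"
    and "K = adjoin_root p emb \<zeta>"
    and "\<mm> = max_ideal_of p emb K"
  shows "padic_log p emb K ` ((+) 1 ` \<mm> - (+) 1 ` (\<mm> \<cdot>\<^bsub>integers_of p emb K\<^esub> \<mm>))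
         = \<mm> \<cdot>\<^bsub>integers_of p emb K\<^esub> \<mm>"
proof -
  interpret padic_cyclotomic p emb \<zeta>
    using assms(1-4) by unfold_locales
  show ?thesis
    unfolding assms(6) unfolding assms(5) K_def[symmetric] max_ideal_eq ideal_prod_E
    by (rule padic_log_image)
qed

end
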